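(* For $0<p_0<p_1<1$ let $$ r^*(p_0,p_1):=\frac{\log\frac{1-p_0}{1-p_1}}{\log\left(\frac{p_1}{p_0}\cdot\frac{1-p_0}{1-p_1}\right)}. $$ Then on the domain $\{0<p_0<p_1<1\}$ the function $r^*(p_0,p_1)$ is strictly monotone increasing in each of its two variables, and $p_0<r^*(p_0,p_1)<p_1$. Fix $0<p_0<p_1<1$. For each $N$ let $M=M(N)$ be an integer with $1\le M\le N$, and let $s(N,M;p_0,p_1)$ be the speed of the random walk excited by its recent history with history window $N$, threshold $M$ and probabilities $p_0,p_1$. If $\frac{M}{N}\to r\in[0,1]$ as $N\to\infty$, then $$ \lim_{N\to\infty}s(N,M;p_0,p_1)=\begin{cases}2p_1-1, & \text{if } 0\le r<r^*(p_0,p_1);\\ 2p_0-1,&\text{if } r^*(p_0,p_1)<r\le 1.\end{cases} $$ If $\frac MN\to r^*(p_0,p_1)$ and $$ \lim_{N\to\infty}\left(\frac{p_0(1-p_1)}{p_1(1-p_0)}\right)^{M-Nr^*(p_0,p_1)}=\alpha\in[0,\infty], $$ then $$ \lim_{N\to\infty}s(N,M;p_0,p_1)=\frac{(2p_0-1)(1-p_1)+(2p_1-1)(1-p_0)\alpha}{1-p_1+(1-p_0)\alpha}, $$ where for $\alpha=\infty$ the right hand side is interpreted as $2p_1-1$.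
   Context: The process (random walk excited by its recent history, single threshold), for integers $1\le M\le N$ and $0<p_0<p_1<1$: $\{X_n\}_{n=0}^\infty$ takes values in $\mathbb{Z}$, starts from a fixed integer $X_0$, and at each step jumps by $+1$ (right) or $-1$ (left). Each of the first $N$ jumps is, independently, to the right with probability $p_0$ and to the left with probability $1-p_0$. At every subsequent step, conditionally on the whole past: if at least $M$ of the $N$ most recent jumps were to the right, the next jump is to the right with probability $p_1$ (and to the left with probability $1-p_1$); if fewer than $M$ of the $N$ most recent jumps were to the right, the next jump is to the right with probability $p_0$ (and to the left with probability $1-p_0$). The speed $s(N,M;p_0,p_1)$ is the deterministic constant $\lim_{n\to\infty}X_n/n$ (almost sure limit; it exists). *)

theory Defs
  imports "HOL-Probability.Probability"
begin

text \<open>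
  The walk is described by its sequence of jumps \<open>J :: nat \<Rightarrow> bool\<close>, where \<open>J k\<close> means that the
  jump from time \<open>k\<close> to time \<open>k + 1\<close> is to the right. Before \<open>N\<close> jumps have been made, the window
  of the \<open>N\<close> most recent jumps is not defined and the probability of a right jump is \<open>p\<^sub>0\<close>.
\<close>

definition right_prob :: "nat \<Rightarrow> nat \<Rightarrow> real \<Rightarrow> real \<Rightarrow> nat \<Rightarrow> (nat \<Rightarrow> bool) \<Rightarrow> real" where
  "right_prob N M p0 p1 n J =
     (if N \<le> n \<and> M \<le> card {k \<in> {n - N..<n}. J k} then p1 else p0)"

definition jump_kernel ::
    "nat \<Rightarrow> nat \<Rightarrow> real \<Rightarrow> real \<Rightarrow> nat \<Rightarrow> (nat \<Rightarrow> bool) \<Rightarrow> bool measure" where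
  "jump_kernel N M p0 p1 n J = measure_pmf (bernoulli_pmf (right_prob N M p0 p1 n J))"

lemma right_prob_cong:
  assumes "\<And>k. k < n \<Longrightarrow> J k = J' k"
  shows "right_prob N M p0 p1 n J = right_prob N M p0 p1 n J'"
proof -
  have "{k \<in> {n - N..<n}. J k} = {k \<in> {n - N..<n}. J' k}"
    using assms by auto
  then show ?thesis by (simp add: right_prob_def)
qed

lemma jump_kernel_cong:
  assumes "\<And>k. k < n \<Longrightarrow> J k = J' k"
  shows "jump_kernel N M p0 p1 n J = jump_kernel N M p0 p1 n J'"
  using right_prob_cong[of n J J' N M p0 p1] assms by (simp add: jump_kernel_def)

lemma PiM_Ico_bool:
  fixes n :: nat
  shows "PiM {0..<n} (\<lambda>_. count_space (UNIV :: bool set)) = count_space ({0..<n} \<rightarrow>\<^sub>E UNIV)"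
  by (intro count_space_PiM_finite) simp_all

global_interpretation jumps: Ionescu_Tulcea "jump_kernel N M p0 p1" "\<lambda>_. count_space UNIV"
  for N M p0 p1
proof (rule Ionescu_Tulcea.intro)
  show "jump_kernel N M p0 p1 i
      \<in> measurable (PiM {0..<i} (\<lambda>_. count_space UNIV)) (subprob_algebra (count_space UNIV))" for i
    unfolding PiM_Ico_bool
    by (auto simp: jump_kernel_def measure_pmf_in_subprob_algebra
             intro!: measurable_count_space_eq1[THEN iffD2])
  show "prob_space (jump_kernel N M p0 p1 i J)" for i J
    unfolding jump_kernel_def by (rule measure_pmf.prob_space_axioms)
qed

text \<open>
  The joint law of all jumps: the measure on jump sequences obtained from the transition kernels
  \<^const>\<open>jump_kernel\<close> by the Ionescu-Tulcea theorem.
\<close>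

definition jump_law :: "nat \<Rightarrow> nat \<Rightarrow> real \<Rightarrow> real \<Rightarrow> (nat \<Rightarrow> bool) measure" where
  "jump_law N M p0 p1 = jumps.PF.lim N M p0 p1"

lemma sets_jump_law [measurable_cong, simp]:
  "sets (jump_law N M p0 p1) = sets (PiM UNIV (\<lambda>_. count_space UNIV))"
  by (simp add: jump_law_def)

lemma space_jump_law [simp]: "space (jump_law N M p0 p1) = UNIV"
  by (simp add: jump_law_def space_PiM)

lemma emeasure_jump_law_prefix:
  "emeasure (jump_law N M p0 p1) {J. \<forall>k<n. J k = h k} =
     emeasure (jumps.C N M p0 p1 0 n (\<lambda>_. undefined)) {restrict h {0..<n}}"
proof -
  have X: "{restrict h {0..<n}} \<in> sets (PiM {0..<n} (\<lambda>_. count_space (UNIV :: bool set)))"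
    by (simp add: PiM_Ico_bool)
  have emb: "jumps.PF.emb UNIV {0..<n} {restrict h {0..<n}} = {J. \<forall>k<n. J k = h k}"
    by (auto simp: prod_emb_def fun_eq_iff restrict_def)
  have emb': "jumps.PF.emb {0..<n} {0..<n} {restrict h {0..<n}} = {restrict h {0..<n}}"
    by (intro prod_emb_id) auto
  show ?thesis
    using jumps.lim[of "{0..<n}" "{restrict h {0..<n}}" N M p0 p1]
      jumps.emeasure_CI[of "{0..<n}" n "{restrict h {0..<n}}" N M p0 p1] X
    by (simp add: emb emb' jump_law_def)
qed

lemma prob_space_jump_law: "prob_space (jump_law N M p0 p1)"
proof (rule prob_spaceI)
  show "emeasure (jump_law N M p0 p1) (space (jump_law N M p0 p1)) = 1"
    using emeasure_jump_law_prefix[of N M p0 p1 0 "\<lambda>_. undefined"]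
    by (simp add: restrict_def PiM_empty)
qed

text \<open>
  Conditionally on the first \<open>n\<close> jumps being given by \<open>h\<close>, the next jump is to the right with
  probability \<open>right_prob N M p0 p1 n h\<close>.
\<close>

lemma emeasure_jump_law_Suc:
  "emeasure (jump_law N M p0 p1) {J. \<forall>k<Suc n. J k = h k} =
     emeasure (jump_law N M p0 p1) {J. \<forall>k<n. J k = h k} *
     ennreal (pmf (bernoulli_pmf (right_prob N M p0 p1 n h)) (h n))"
proof -
  let ?C = "jumps.C N M p0 p1 0" and ?u = "\<lambda>_. undefined :: bool"
  let ?M = "\<lambda>n :: nat. PiM {0..<n} (\<lambda>_. count_space (UNIV :: bool set))"
  let ?c = "ennreal (pmf (bernoulli_pmf (right_prob N M p0 p1 n h)) (h n))"
  have u: "?u \<in> space (?M 0)" by (simp add: space_PiM PiE_def extensional_def)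
  have sets_C: "sets (?C n ?u) = sets (?M n)" and space_C: "space (?C n ?u) = space (?M n)"
    using jumps.sets_C[OF u, of N M p0 p1 n] jumps.space_C[OF u, of N M p0 p1 n] by simp_all
  have eP: "emeasure (jumps.eP N M p0 p1 n J) {restrict h {0..<Suc n}} =
      ?c * indicator {restrict h {0..<n}} J" if J: "J \<in> space (?M n)" for J
  proof -
    have Jx: "J k = undefined" if "k \<ge> n" for k
      using J that by (auto simp: space_PiM PiE_def extensional_def)
    have "{restrict h {0..<Suc n}} \<in> sets (?M (Suc n))" by (simp add: PiM_Ico_bool del: restrict_apply)
    then have "emeasure (jumps.eP N M p0 p1 n J) {restrict h {0..<Suc n}} =
        emeasure (jump_kernel N M p0 p1 n J) {b. J(n := b) = restrict h {0..<Suc n}}"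
      by (subst jumps.emeasure_eP[OF J]) (auto intro!: arg_cong2[where f=emeasure])
    also have "{b. J(n := b) = restrict h {0..<Suc n}} =
        (if J = restrict h {0..<n} then {h n} else {})"
    proof -
      have "J(n := b) = restrict h {0..<Suc n} \<longleftrightarrow> J = restrict h {0..<n} \<and> b = h n" for b
        using Jx by (auto simp: fun_eq_iff less_Suc_eq)
      then show ?thesis by auto
    qed
    also have "emeasure (jump_kernel N M p0 p1 n J) (if J = restrict h {0..<n} then {h n} else {}) =
        ?c * indicator {restrict h {0..<n}} J"
      using jump_kernel_cong[of n "restrict h {0..<n}" h N M p0 p1]
      by (auto simp: jump_kernel_def emeasure_pmf_single)
    finally show ?thesis .
  qed
  have "emeasure (?C (Suc n) ?u) {restrict h {0..<Suc n}} =
      (\<integral>\<^sup>+J. emeasure (jumps.eP N M p0 p1 n J) {restrict h {0..<Suc n}} \<partial>?C n ?u)"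
  proof -
    have ne: "space (?C n ?u) \<noteq> {}"
      unfolding space_C by (simp add: space_PiM PiE_eq_empty_iff)
    have X: "{restrict h {0..<Suc n}} \<in> sets (?M (Suc n))" by (simp add: PiM_Ico_bool del: restrict_apply)
    have m: "jumps.eP N M p0 p1 n \<in> measurable (?C n ?u) (subprob_algebra (?M (Suc n)))"
      using jumps.measurable_eP[of N M p0 p1 n] by (simp add: measurable_cong_sets[OF sets_C refl])
    show ?thesis
      using emeasure_bind[OF ne m X] by simp
  qed
  also have "\<dots> = (\<integral>\<^sup>+J. ?c * indicator {restrict h {0..<n}} J \<partial>?C n ?u)"
    by (intro nn_integral_cong) (simp add: space_C eP)
  also have "\<dots> = ?c * emeasure (?C n ?u) {restrict h {0..<n}}"
    by (rule nn_integral_cmult_indicator) (simp add: sets_C PiM_Ico_bool)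
  finally show ?thesis
    by (simp only: emeasure_jump_law_prefix mult.commute)
qed

definition walk :: "int \<Rightarrow> (nat \<Rightarrow> bool) \<Rightarrow> nat \<Rightarrow> int" where
  "walk x0 J n = x0 + (\<Sum>k<n. if J k then 1 else - 1)"

text \<open>
  The constant \<open>s\<close> is unique if it exists, because \<^const>\<open>jump_law\<close> is a probability measure.
\<close>

definition speed :: "int \<Rightarrow> nat \<Rightarrow> nat \<Rightarrow> real \<Rightarrow> real \<Rightarrow> real" where
  "speed x0 N M p0 p1 =
     (THE s. AE J in jump_law N M p0 p1. (\<lambda>n. real_of_int (walk x0 J n) / real n) \<longlonglongrightarrow> s)"

definition r_star :: "real \<Rightarrow> real \<Rightarrow> real" where
  "r_star p0 p1 =
     ln ((1 - p0) / (1 - p1)) / ln (p1 / p0 * ((1 - p0) / (1 - p1)))"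

end

theory Submission
  imports Defs "HOL-Probability.Hoeffding" "HOL-Library.Discrete_Functions"
begin

text \<open>
  Under the stationary law of the window of the last \<open>N\<close> jumps, a window containing \<open>k\<close> right jumps
  has a weight proportional to \<open>p\<^sub>0\<^sup>k (1 - p\<^sub>0)\<^sup>N\<^sup>-\<^sup>k\<close> for \<open>k < M\<close> and to
  \<open>p\<^sub>1\<^sup>k (1 - p\<^sub>1)\<^sup>N\<^sup>-\<^sup>k\<close> for \<open>k \<ge> M\<close>, so the speed is an explicit average of
  \<open>2 p\<^sub>0 - 1\<close> and \<open>2 p\<^sub>1 - 1\<close> with weights \<open>P(Bin(N, p\<^sub>0) < M)\<close> and
  \<open>(1 - p\<^sub>0) / (1 - p\<^sub>1) c\<^sup>M\<^sup>-\<^sup>N\<^sup>r P(Bin(N, p\<^sub>1) \<ge> M)\<close>, where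
  \<open>c = p\<^sub>0 (1 - p\<^sub>1) / (p\<^sub>1 (1 - p\<^sub>0))\<close> and \<open>r = r_star p\<^sub>0 p\<^sub>1\<close>.
  Since \<open>p\<^sub>0 < r < p\<^sub>1\<close>, near the critical ratio both binomial probabilities tend to 1 and only the
  power of \<open>c\<close> decides.

  The window frequencies converge almost surely to the stationary law: the martingale
  differences given by the jumps out of a fixed window average to 0, so the ratio of frequency to
  stationary weight is asymptotically harmonic for the time-reversed window chain, which follows the
  same rule as the original one, and asymptotically harmonic functions have vanishing oscillation.

  The point \<open>r\<close> is the parameter at which the Bernoulli log-likelihoods of \<open>p\<^sub>0\<close> and \<open>p\<^sub>1\<close> agree; its
  monotonicity comes from the unimodality of the log-likelihood.
\<close>

section \<open>The critical ratio\<close>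

definition bern_loglik :: "real \<Rightarrow> real \<Rightarrow> real" where
  "bern_loglik r x = r * ln x + (1 - r) * ln (1 - x)"

text \<open>The derivative in \<open>x\<close> is \<open>(r - x) / (x * (1 - x))\<close>, which is
  positive below \<open>r\<close>. It is only evaluated inside the open interval, so
  \<open>y = r\<close> is covered.\<close>

lemma bern_loglik_less_left:
  assumes "0 < x" "x < y" "y \<le> r" "y < 1"
  shows "bern_loglik r x < bern_loglik r y"
proof (rule DERIV_pos_imp_increasing_open[OF \<open>x < y\<close>])
  fix t assume t: "x < t" "t < y"
  have "(bern_loglik r has_real_derivative r / t - (1 - r) / (1 - t)) (at t)"
    unfolding bern_loglik_def [abs_def] using assms t
    by (auto intro!: derivative_eq_intros simp: divide_inverse algebra_simps)
  moreover have "r / t - (1 - r) / (1 - t) > 0"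
    using assms t by (simp add: field_simps)
  ultimately show "\<exists>d. (bern_loglik r has_real_derivative d) (at t) \<and> 0 < d" by blast
next
  show "continuous_on {x..y} (bern_loglik r)"
    unfolding bern_loglik_def [abs_def] using assms
    by (intro continuous_intros) auto
qed

text \<open>Exchanging right and left jumps, \<open>x\<close> with \<open>1 - x\<close> and
  \<open>r\<close> with \<open>1 - r\<close>, preserves the log-likelihood and reverses the
  order.\<close>

lemma bern_loglik_less_right:
  assumes "r \<le> x" "x < y" "0 < x" "y < 1"
  shows "bern_loglik r y < bern_loglik r x"
  using bern_loglik_less_left[of "1 - y" "1 - x" "1 - r"] assms by (simp add: bern_loglik_def add.commute)

lemma r_star_denominator_pos:
  fixes a b :: real
  assumes "0 < a" "a < b" "b < 1"
  shows "0 < ln (b / a * ((1 - a) / (1 - b)))"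
  using assms by (intro ln_gt_zero) (simp add: field_simps)

text \<open>For fixed parameters both log-likelihoods are affine in \<open>r\<close>, and
  \<open>r_star\<close> is the point where the two lines cross.\<close>

lemma bern_loglik_diff:
  assumes "0 < a" "a < b" "b < 1"
  shows "bern_loglik r a - bern_loglik r b =
    (r_star a b - r) * ln (b / a * ((1 - a) / (1 - b)))"
proof -
  define D where "D = ln (b / a * ((1 - a) / (1 - b)))"
  have "r_star a b * D = ln ((1 - a) / (1 - b))"
    using r_star_denominator_pos[OF assms] by (simp add: r_star_def D_def)
  then have sD: "r_star a b * D = ln (1 - a) - ln (1 - b)"
    using assms by (simp add: ln_div)
  have "D = ln b - ln a + (ln (1 - a) - ln (1 - b))"
    unfolding D_def using assms by (simp add: ln_mult ln_div del: times_divide_eq_left times_divide_eq_right)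
  then have "r * D = r * (ln b - ln a + (ln (1 - a) - ln (1 - b)))" by simp
  with sD have "bern_loglik r a - bern_loglik r b = (r_star a b - r) * D"
    by (simp add: bern_loglik_def algebra_simps)
  then show ?thesis by (simp add: D_def)
qed

lemma less_r_star_iff:
  assumes "0 < a" "a < b" "b < 1"
  shows "r < r_star a b \<longleftrightarrow> bern_loglik r b < bern_loglik r a"
    and "r_star a b < r \<longleftrightarrow> bern_loglik r a < bern_loglik r b"
proof -
  note d = bern_loglik_diff[OF assms, of r] and p = r_star_denominator_pos[OF assms]
  have "0 < bern_loglik r a - bern_loglik r b \<longleftrightarrow> 0 < r_star a b - r"
    unfolding d using p by (simp add: zero_less_mult_iff)
  then show "r < r_star a b \<longleftrightarrow> bern_loglik r b < bern_loglik r a" by linarith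
  have "bern_loglik r a - bern_loglik r b < 0 \<longleftrightarrow> r_star a b - r < 0"
    unfolding d using p by (simp add: mult_less_0_iff)
  then show "r_star a b < r \<longleftrightarrow> bern_loglik r a < bern_loglik r b" by linarith
qed

text \<open>Each parameter is the strict maximiser of its own log-likelihood: at
  \<open>r = a\<close> the parameter \<open>a\<close> fits better than \<open>b\<close>, at
  \<open>r = b\<close> worse, so the crossing lies in between.\<close>

lemma r_star_bounds:
  assumes "0 < a" "a < b" "b < 1"
  shows "a < r_star a b" "r_star a b < b"
  using less_r_star_iff[OF assms] bern_loglik_less_left[of a b b] bern_loglik_less_right[of a a b] assms
  by auto

text \<open>At \<open>r = r_star a b\<close> the parameters \<open>a\<close> and \<open>b\<close>
  fit equally well. Moving \<open>a\<close> up towards \<open>r\<close> strictly improves its fit,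
  so \<open>r\<close> lies left of the new crossing. If \<open>a'\<close> has already reached
  \<open>r\<close>, the bounds on \<open>r_star a' b\<close> suffice.\<close>

lemma r_star_mono_left:
  assumes "0 < a" "a < a'" "a' < b" "b < 1"
  shows "r_star a b < r_star a' b"
proof (cases "r_star a b \<le> a'")
  case True
  then show ?thesis using r_star_bounds[of a' b] assms by auto
next
  case False
  then have "bern_loglik (r_star a b) a < bern_loglik (r_star a b) a'"
    using assms by (intro bern_loglik_less_left) auto
  moreover have "bern_loglik (r_star a b) a = bern_loglik (r_star a b) b"
    using bern_loglik_diff[of a b "r_star a b"] assms by simp
  ultimately show ?thesis using less_r_star_iff(1)[of a' b] assms by simp
qed

text \<open>The mirror argument is run at \<open>r = r_star a b'\<close>: lowering \<open>b'\<close>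
  to \<open>b\<close> brings it closer to this point, so \<open>b\<close> fits better than
  \<open>a\<close> there and the crossing for \<open>b\<close> lies further left.\<close>

lemma r_star_mono_right:
  assumes "0 < a" "a < b" "b < b'" "b' < 1"
  shows "r_star a b < r_star a b'"
proof (cases "b \<le> r_star a b'")
  case True
  then show ?thesis using r_star_bounds[of a b] assms by auto
next
  case False
  then have "bern_loglik (r_star a b') b' < bern_loglik (r_star a b') b"
    using assms by (intro bern_loglik_less_right) auto
  moreover have "bern_loglik (r_star a b') a = bern_loglik (r_star a b') b'"
    using bern_loglik_diff[of a b' "r_star a b'"] assms by simp
  ultimately show ?thesis using less_r_star_iff(2)[of a b] assms by simp
qed

section \<open>Averages of bounded orthogonal random variables\<close>

text \<open>At most \<open>2 * m\<close> terms lie between the last square \<open>m\<^sup>2\<close>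
  and \<open>n\<close>. Being bounded by \<open>C\<close>, they change the average by at most
  \<open>2 * C / m\<close>.\<close>

lemma averages_tendsto_0_along_squares:
  fixes x :: "nat \<Rightarrow> real"
  assumes bound: "\<And>k. \<bar>x k\<bar> \<le> C"
    and sq: "(\<lambda>m. (\<Sum>k<m\<^sup>2. x k) / real (m\<^sup>2)) \<longlonglongrightarrow> 0"
  shows "(\<lambda>n. (\<Sum>k<n. x k) / real n) \<longlonglongrightarrow> 0"
proof -
  define S where "S n = (\<Sum>k<n. x k)" for n
  have C: "0 \<le> C" using bound[of 0] by linarith
  have step: "\<bar>S n - S m\<bar> \<le> C * real (n - m)" if "m \<le> n" for m n
  proof -
    have "S n = S m + (\<Sum>k=m..<n. x k)"
      unfolding S_def using that by (metis lessThan_atLeast0 sum.atLeastLessThan_concat zero_le)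
    moreover have "\<bar>\<Sum>k=m..<n. x k\<bar> \<le> (\<Sum>k=m..<n. C)"
      by (rule sum_abs[THEN order_trans]) (intro sum_mono bound)
    ultimately show ?thesis by (simp add: mult.commute)
  qed
  have sqrt_lim: "filterlim floor_sqrt at_top sequentially"
    unfolding filterlim_at_top
  proof
    fix Z show "\<forall>\<^sub>F n in sequentially. Z \<le> floor_sqrt n"
      using eventually_ge_at_top[of "Z\<^sup>2"]
      by eventually_elim (simp add: le_floor_sqrt_iff)
  qed
  have lim: "(\<lambda>n. \<bar>S ((floor_sqrt n)\<^sup>2) / real ((floor_sqrt n)\<^sup>2)\<bar> + 2 * C * inverse (real (floor_sqrt n))) \<longlonglongrightarrow> 0"
  proof -
    have "(\<lambda>m. \<bar>S (m\<^sup>2) / real (m\<^sup>2)\<bar> + 2 * C * inverse (real m)) \<longlonglongrightarrow> \<bar>0\<bar> + 2 * C * 0"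
      using sq unfolding S_def by (intro tendsto_intros lim_inverse_n)
    then show ?thesis 
      by (auto dest: filterlim_compose[OF _ sqrt_lim])
  qed
  have "\<forall>\<^sub>F n in sequentially. norm (S n / real n) \<le>
      \<bar>S ((floor_sqrt n)\<^sup>2) / real ((floor_sqrt n)\<^sup>2)\<bar> + 2 * C * inverse (real (floor_sqrt n))"
    using eventually_gt_at_top[of 0]
  proof eventually_elim
    case (elim n)
    define m where "m = floor_sqrt n"
    have m0: "0 < m" using elim by (simp add: m_def)
    have le: "m\<^sup>2 \<le> n" by (simp add: m_def)
    have "n < (Suc m)\<^sup>2" unfolding m_def by (rule Suc_floor_sqrt_power2_gt)
    then have "n - m\<^sup>2 \<le> 2 * m" by (simp add: power2_eq_square)
    then have "\<bar>S n - S (m\<^sup>2)\<bar> \<le> C * real (2 * m)"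
      using step[OF le] C by (meson mult_left_mono of_nat_mono order_trans)
    then have "\<bar>S n\<bar> \<le> \<bar>S (m\<^sup>2)\<bar> + 2 * C * m" by simp
    then have "\<bar>S n\<bar> / n \<le> (\<bar>S (m\<^sup>2)\<bar> + 2 * C * m) / n"
      by (rule divide_right_mono) simp
    also have "\<dots> \<le> (\<bar>S (m\<^sup>2)\<bar> + 2 * C * m) / real (m\<^sup>2)"
    proof (rule divide_left_mono)
      show "real (m\<^sup>2) \<le> real n" using le by (rule of_nat_mono)
    qed (use C m0 elim in auto)
    also have "\<dots> = \<bar>S (m\<^sup>2) / real (m\<^sup>2)\<bar> + 2 * C * inverse (real m)"
      using m0 by (simp add: field_simps power2_eq_square)
    finally show ?case by (simp add: m_def)
  qed
  then have "(\<lambda>n. S n / real n) \<longlonglongrightarrow> 0" by (rule Lim_null_comparison[OF _ lim])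
  then show ?thesis by (simp add: S_def)
qed

text \<open>The cross terms vanish, so the average of the first \<open>m\<^sup>2\<close> variables
  has second moment at most \<open>C\<^sup>2 / m\<^sup>2\<close>. This is summable in
  \<open>m\<close>, so the squared averages have an almost surely finite sum and tend to 0 along the
  squares; boundedness fills the gaps.\<close>

lemma (in prob_space) bounded_orthogonal_averages_tendsto_0:
  fixes X :: "nat \<Rightarrow> 'a \<Rightarrow> real"
  assumes [measurable]: "\<And>k. X k \<in> borel_measurable M"
    and bound: "\<And>k x. \<bar>X k x\<bar> \<le> C"
    and orth: "\<And>i j. i < j \<Longrightarrow> expectation (\<lambda>x. X i x * X j x) = 0"
  shows "AE x in M. (\<lambda>n. (\<Sum>k<n. X k x) / real n) \<longlonglongrightarrow> 0"
proof -
  have C: "0 \<le> C" using bound[of 0 undefined] by linarith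
  have bound2: "\<bar>X i x * X j x\<bar> \<le> C\<^sup>2" for i j x
    using mult_mono[OF bound[of i x] bound[of j x]] C by (simp add: abs_mult power2_eq_square)
  have int: "integrable M (\<lambda>x. X i x * X j x)" for i j
    by (rule integrable_const_bound[of _ "C\<^sup>2"]) (use bound2 in auto)
  have E: "expectation (\<lambda>x. X i x * X j x) \<le> (if i = j then C\<^sup>2 else 0)" for i j
  proof (cases "i = j")
    case True
    then show ?thesis
      using bound2[of i _ j] by (auto intro!: integral_le_const int intro: order_trans[OF abs_ge_self])
  next
    case False
    then show ?thesis
      using orth[of i j] orth[of j i] by (cases i j rule: linorder_cases) (simp_all add: mult.commute)
  qed
  define T where "T m x = ((\<Sum>k<m\<^sup>2. X k x) / real (m\<^sup>2))\<^sup>2" for m x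
  have T_eq: "T m x = (\<Sum>i<m\<^sup>2. \<Sum>j<m\<^sup>2. X i x * X j x) * inverse ((real (m\<^sup>2))\<^sup>2)" for m x
    by (simp add: T_def power_divide power2_eq_square[of "sum _ _"] sum_product field_simps)
  have intT: "integrable M (T m)" for m
    unfolding T_eq by (intro integrable_mult_left Bochner_Integration.integrable_sum int)
  have ET: "expectation (T m) \<le> C\<^sup>2 * inverse ((real m)\<^sup>2)" for m
  proof -
    have "expectation (T m) =
        (\<Sum>i<m\<^sup>2. \<Sum>j<m\<^sup>2. expectation (\<lambda>x. X i x * X j x)) * inverse ((real (m\<^sup>2))\<^sup>2)"
      unfolding T_eq by (simp add: int)
    also have "\<dots> \<le> (\<Sum>i<m\<^sup>2. \<Sum>j<m\<^sup>2. if i = j then C\<^sup>2 else 0) * inverse ((real (m\<^sup>2))\<^sup>2)"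
      by (intro mult_right_mono sum_mono E) simp
    also have "\<dots> = C\<^sup>2 * inverse ((real m)\<^sup>2)"
      by (cases "m = 0") (simp_all add: field_simps power2_eq_square)
    finally show ?thesis .
  qed
  have [measurable]: "T m \<in> borel_measurable M" for m
    unfolding T_def by measurable
  have "(\<integral>\<^sup>+x. (\<Sum>m. ennreal (T m x)) \<partial>M) = (\<Sum>m. \<integral>\<^sup>+x. ennreal (T m x) \<partial>M)"
    by (rule nn_integral_suminf) measurable
  also have "\<dots> = (\<Sum>m. ennreal (expectation (T m)))"
    by (intro suminf_cong nn_integral_eq_integral intT) (simp add: T_def)
  also have "\<dots> \<le> (\<Sum>m. ennreal (C\<^sup>2 * inverse ((real m)\<^sup>2)))"
    by (intro suminf_le ennreal_leI ET) auto
  also have "\<dots> < \<infinity>"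
  proof -
    have "summable (\<lambda>m. C\<^sup>2 * inverse ((real m)\<^sup>2))"
      by (intro summable_mult inverse_power_summable) simp
    then show ?thesis by (subst suminf_ennreal2) auto
  qed
  finally have "AE x in M. (\<Sum>m. ennreal (T m x)) \<noteq> \<infinity>"
    by (intro nn_integral_PInf_AE) auto
  then show ?thesis
  proof eventually_elim
    case (elim x)
    have "summable (\<lambda>m. T m x)"
      using elim by (intro summable_suminf_not_top) (auto simp: T_def)
    then have "(\<lambda>m. sqrt (T m x)) \<longlonglongrightarrow> sqrt 0"
      by (intro tendsto_real_sqrt summable_LIMSEQ_zero)
    then have "(\<lambda>m. \<bar>(\<Sum>k<m\<^sup>2. X k x) / real (m\<^sup>2)\<bar>) \<longlonglongrightarrow> 0"
      by (simp add: T_def)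
    then have "(\<lambda>m. (\<Sum>k<m\<^sup>2. X k x) / real (m\<^sup>2)) \<longlonglongrightarrow> 0"
      by (rule tendsto_rabs_zero_cancel)
    then show ?case by (rule averages_tendsto_0_along_squares[OF bound])
  qed
qed

section \<open>Sums over windows and almost harmonic functions\<close>

lemma finite_lists_length [simp]: "finite {v :: bool list. length v = n}"
  using finite_lists_length_eq[of "UNIV :: bool set" n] by simp

lemma sum_lists_Suc:
  fixes F :: "bool list \<Rightarrow> real"
  shows "(\<Sum>v | length v = Suc n. F v) = (\<Sum>v | length v = n. F (True # v) + F (False # v))"
proof -
  have eq: "{v :: bool list. length v = Suc n} =
      (#) True ` {v. length v = n} \<union> (#) False ` {v. length v = n}"
    by (auto simp: length_Suc_conv image_iff)
  show ?thesis
    unfolding eq by (subst sum.union_disjoint) (auto simp: sum.reindex sum.distrib)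
qed

text \<open>Splitting off the first letter gives Pascal's rule. Sums over windows that depend only
  on the number of right jumps thereby become binomial sums.\<close>

lemma sum_lists_count:
  fixes F :: "nat \<Rightarrow> real"
  shows "(\<Sum>v | length v = n. F (count_list v True)) = (\<Sum>k\<le>n. real (n choose k) * F k)"
proof (induction n arbitrary: F)
  case (Suc n)
  have "(\<Sum>k\<le>Suc n. real (Suc n choose k) * F k) =
      F 0 + (\<Sum>k\<le>n. real (n choose k) * F (Suc k) + real (n choose Suc k) * F (Suc k))"
    by (subst sum.atMost_Suc_shift) (simp add: algebra_simps)
  also have "\<dots> = (\<Sum>k\<le>n. real (n choose k) * F (Suc k)) + (\<Sum>k\<le>Suc n. real (n choose k) * F k)"
    using sum.atMost_Suc_shift[of "\<lambda>k. real (n choose k) * F k" n] by (simp add: sum.distrib)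
  also have "(\<Sum>k\<le>Suc n. real (n choose k) * F k) = (\<Sum>k\<le>n. real (n choose k) * F k)"
    by simp
  finally show ?case
    using Suc.IH[of "\<lambda>k. F (Suc k)"] Suc.IH[of F] by (simp add: sum_lists_Suc sum.distrib)
qed simp

text \<open>
  A maximum of \<open>h\<close> at a window forces values almost as large at both of its predecessors, and every
  window is reached from every other one in exactly \<open>N\<close> backward steps.
\<close>

lemma oscillation_bound:
  fixes h :: "bool list \<Rightarrow> real" and r :: "bool list \<Rightarrow> real"
  assumes \<delta>: "0 < \<delta>" "\<And>v. \<delta> \<le> r v" "\<And>v. r v \<le> 1 - \<delta>"
    and harm: "\<And>xs y. length (xs @ [y]) = N \<Longrightarrow>
      \<bar>h (xs @ [y]) - (r (xs @ [y]) * h (True # xs) + (1 - r (xs @ [y])) * h (False # xs))\<bar> \<le> e"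
    and e: "0 \<le> e" and uv: "length u = N" "length v = N"
  shows "\<bar>h v - h u\<bar> \<le> real N * e / \<delta> ^ N"
proof -
  define m where "m = Max (h ` {v. length v = N})"
  have "m \<in> h ` {v. length v = N}" unfolding m_def using uv by (intro Max_in) auto
  then obtain w where w: "length w = N" "m = h w" by auto
  have m: "h x \<le> m" if "length x = N" for x
    unfolding m_def using that by (intro Max_ge) auto
  have \<delta>1: "\<delta> \<le> 1" using \<delta>(2,3)[of u] by linarith
  \<comment> \<open>The window here arises from the maximiser \<open>w\<close> by prepending the
    letters of \<open>s\<close> and dropping equally many at the end. Each backward step adds at
    most \<open>e\<close> to the distance from the maximum and then divides it by at least
    \<open>\<delta>\<close>.\<close>
  have gap: "m - h (s @ take (N - length s) w) \<le> real (length s) * e / \<delta> ^ length s"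
    if "length s \<le> N" for s
    using that
  proof (induction s)
    case (Cons x s)
    define j where "j = N - Suc (length s)"
    define xs where "xs = s @ take j w"
    define y where "y = w ! j"
    have j: "N - length s = Suc j" "j < length w" using Cons.prems w by (auto simp: j_def)
    have len: "length (xs @ [y]) = N" using Cons.prems w by (auto simp: xs_def j_def)
    have t: "s @ take (N - length s) w = xs @ [y]"
      using j by (simp add: xs_def y_def take_Suc_conv_app_nth)
    have IH: "m - h (xs @ [y]) \<le> real (length s) * e / \<delta> ^ length s"
      using Cons by (simp add: t)
    let ?r = "r (xs @ [y])"
    have g: "0 \<le> m - h (z # xs)" for z using m[of "z # xs"] len by simp
    have "\<delta> * (m - h (x # xs)) \<le> ?r * (m - h (True # xs)) + (1 - ?r) * (m - h (False # xs))"
    proof (cases x)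
      case True
      then show ?thesis
        using mult_right_mono[OF \<delta>(2)[of "xs @ [y]"] g[of True]] mult_nonneg_nonneg[of "1 - ?r", OF _ g[of False]]
          \<delta>(1) \<delta>(3)[of "xs @ [y]"] by auto
    next
      case False
      then show ?thesis
        using mult_right_mono[of \<delta> "1 - ?r", OF _ g[of False]] mult_nonneg_nonneg[of ?r, OF _ g[of True]]
          \<delta>(1) \<delta>(2,3)[of "xs @ [y]"] by auto
    qed
    also have "\<dots> = m - (?r * h (True # xs) + (1 - ?r) * h (False # xs))"
      by (simp add: algebra_simps)
    also have "\<dots> \<le> real (length s) * e / \<delta> ^ length s + e"
      using IH harm[OF len] by linarith
    finally have "\<delta> * (m - h (x # xs)) \<le> real (length s) * e / \<delta> ^ length s + e" .
    moreover have "e \<le> e / \<delta> ^ length s"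
      using e \<delta>1 \<delta>(1) by (simp add: pos_le_divide_eq power_le_one mult_left_le)
    ultimately have "\<delta> * (m - h (x # xs)) \<le> (real (length s) * e + e) / \<delta> ^ length s"
      by (simp add: add_divide_distrib)
    then have "m - h (x # xs) \<le> (real (length s) * e + e) / \<delta> ^ length s / \<delta>"
      using \<delta>(1) by (simp add: pos_le_divide_eq ac_simps)
    then show ?case by (simp add: xs_def j_def algebra_simps)
  qed (use w in simp)
  \<comment> \<open>At full length nothing of \<open>w\<close> is left, so \<open>z\<close> is an
    arbitrary window.\<close>
  have "m - h z \<le> real N * e / \<delta> ^ N" if "length z = N" for z using gap[of z] that by simp
  from this[of u] this[of v] m[of u] m[of v] uv show ?thesis by auto
qed

section \<open>Jumps out of a fixed window\<close>

definition rule_prob :: "nat \<Rightarrow> real \<Rightarrow> real \<Rightarrow> nat \<Rightarrow> real" where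
  "rule_prob M p0 p1 k = (if M \<le> k then p1 else p0)"

lemma count_list_map_True: "count_list (map J xs) True = length (filter J xs)"
  by (induction xs) auto

lemma right_prob_window:
  "right_prob N M p0 p1 (k + N) J = rule_prob M p0 p1 (count_list (map J [k..<k + N]) True)"
proof -
  have "count_list (map J [k..<k + N]) True = card (set (filter J [k..<k + N]))"
    by (simp only: count_list_map_True distinct_card distinct_filter distinct_upt)
  also have "set (filter J [k..<k + N]) = {i \<in> {k..<k + N}. J i}" by auto
  finally show ?thesis by (simp add: right_prob_def rule_prob_def)
qed

section \<open>Conditional law of the next jump given the past\<close>

lemma measurable_jump_law_prefix [measurable]:
  "{J. \<forall>k<n. J k = h k} \<in> sets (jump_law N M p0 p1)"
proof -
  have "{J \<in> space (PiM UNIV (\<lambda>_. count_space (UNIV :: bool set))). \<forall>k<n. J k = h k}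
      \<in> sets (PiM UNIV (\<lambda>_. count_space (UNIV :: bool set)))"
    by measurable
  then show ?thesis by (simp add: space_PiM)
qed

lemma measure_jump_law_prefix_True:
  assumes p: "0 \<le> p0" "p0 \<le> 1" "0 \<le> p1" "p1 \<le> 1"
  shows "measure (jump_law N M p0 p1) {J. (\<forall>k<n. J k = h k) \<and> J n} =
    measure (jump_law N M p0 p1) {J. \<forall>k<n. J k = h k} * right_prob N M p0 p1 n h"
proof -
  let ?h = "h(n := True)"
  have "{J. \<forall>k<Suc n. J k = ?h k} = {J. (\<forall>k<n. J k = h k) \<and> J n}"
    "{J. \<forall>k<n. J k = ?h k} = {J. \<forall>k<n. J k = h k}"
    by (auto simp: less_Suc_eq)
  moreover have "right_prob N M p0 p1 n ?h = right_prob N M p0 p1 n h"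
    by (rule right_prob_cong) simp
  moreover have "0 \<le> right_prob N M p0 p1 n h" "right_prob N M p0 p1 n h \<le> 1"
    using p by (auto simp: right_prob_def)
  ultimately show ?thesis
    using emeasure_jump_law_Suc[of N M p0 p1 n ?h] by (simp add: measure_def enn2real_mult)
qed

text \<open>\<open>G\<close> is constant on each of the finitely many cylinders given by a prefix of
  length \<open>m\<close>, and on each cylinder the centring cancels the conditional probability of
  a right jump.\<close>

lemma expectation_centred_jump:
  fixes G :: "(nat \<Rightarrow> bool) \<Rightarrow> real"
  assumes p: "0 \<le> p0" "p0 \<le> 1" "0 \<le> p1" "p1 \<le> 1"
    and G: "\<And>J J'. (\<And>k. k < m \<Longrightarrow> J k = J' k) \<Longrightarrow> G J = G J'"
  shows "(\<integral>J. G J * (of_bool (J m) - right_prob N M p0 p1 m J) \<partial>jump_law N M p0 p1) = 0"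
proof -
  interpret prob_space "jump_law N M p0 p1" by (rule prob_space_jump_law)
  \<comment> \<open>A prefix of length \<open>m\<close> is padded with \<open>False\<close>; neither
    \<open>G\<close> nor \<open>right_prob\<close> at \<open>m\<close> sees the padding.\<close>
  define ext where "ext h k \<longleftrightarrow> k < m \<and> h ! k" for h k
  define A where "A h = {J. \<forall>k<m. J k = ext h k}" for h
  define B where "B h = {J. (\<forall>k<m. J k = ext h k) \<and> J m}" for h
  let ?q = "right_prob N M p0 p1 m"
  have B_eq: "B h = {J. \<forall>k<Suc m. J k = ((ext h)(m := True)) k}" for h
    by (auto simp: B_def less_Suc_eq)
  have AB [measurable]: "A h \<in> events" "B h \<in> events" for h
    unfolding B_eq by (simp_all only: A_def measurable_jump_law_prefix)
  have int: "integrable (jump_law N M p0 p1) (indicat_real (A h))"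
    "integrable (jump_law N M p0 p1) (indicat_real (B h))" for h
    by (auto intro!: integrable_real_indicator AB simp: less_top[symmetric])
  have A: "J \<in> A h \<longleftrightarrow> h = map J [0..<m]" if "length h = m" for h J
    using that by (auto simp: A_def ext_def list_eq_iff_nth_eq)
  have eq: "G J * (of_bool (J m) - ?q J) =
      (\<Sum>h | length h = m. G (ext h) * (indicator (B h) J - ?q (ext h) * indicator (A h) J))" for J
  proof -
    have "(\<Sum>h | length h = m. G (ext h) * (indicator (B h) J - ?q (ext h) * indicator (A h) J)) =
        (\<Sum>h | length h = m. if h = map J [0..<m] then G J * (of_bool (J m) - ?q J) else 0)"
    proof (intro sum.cong refl)
      fix h assume h: "h \<in> {h :: bool list. length h = m}"
      show "G (ext h) * (indicator (B h) J - ?q (ext h) * indicator (A h) J) =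
        (if h = map J [0..<m] then G J * (of_bool (J m) - ?q J) else 0)"
      proof (cases "h = map J [0..<m]")
        case True
        then have JA: "J \<in> A h" using A h by auto
        then have "G (ext h) = G J" "?q (ext h) = ?q J"
          by (auto simp: A_def intro!: G right_prob_cong)
        moreover have "J \<in> B h \<longleftrightarrow> J m" using JA by (auto simp: A_def B_def)
        ultimately show ?thesis using True JA by (simp add: indicator_def)
      next
        case False
        then have "J \<notin> A h" "J \<notin> B h" using A h by (auto simp: A_def B_def)
        then show ?thesis using False by simp
      qed
    qed
    then show ?thesis by simp
  qed
  have "expectation (\<lambda>J. G J * (of_bool (J m) - ?q J)) =
      (\<Sum>h | length h = m. G (ext h) * (prob (B h) - ?q (ext h) * prob (A h)))"
    unfolding eq using int by simp
  also have "\<dots> = 0"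
    using measure_jump_law_prefix_True[OF p] by (simp add: A_def B_def)
  finally show ?thesis .
qed

text \<open>The summands are martingale differences bounded by 1, hence pairwise orthogonal, and the
  law of large numbers for orthogonal variables applies.\<close>

lemma AE_window_averages:
  assumes p: "0 \<le> p0" "p0 \<le> 1" "0 \<le> p1" "p1 \<le> 1"
  shows "AE J in jump_law N M p0 p1. (\<lambda>n. (\<Sum>k<n. of_bool (map J [k..<k + N] = v) *
    (of_bool (J (k + N)) - rule_prob M p0 p1 (count_list v True))) / real n) \<longlonglongrightarrow> 0"
proof -
  interpret prob_space "jump_law N M p0 p1" by (rule prob_space_jump_law)
  let ?q = "rule_prob M p0 p1 (count_list v True)"
  define X :: "nat \<Rightarrow> (nat \<Rightarrow> bool) \<Rightarrow> real" where
    "X k J = of_bool (map J [k..<k + N] = v) * (of_bool (J (k + N)) - ?q)" for k J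
  have X_alt: "X k J = of_bool (length v = N \<and> (\<forall>i<N. J (k + i) = v ! i)) * (of_bool (J (k + N)) - ?q)"
    for k J
    by (auto simp: X_def list_eq_iff_nth_eq)
  have meas: "X k \<in> borel_measurable (jump_law N M p0 p1)" for k
  proof -
    have "X k \<in> borel_measurable (PiM UNIV (\<lambda>_. count_space (UNIV :: bool set)))"
      unfolding X_alt by measurable
    then show ?thesis by (simp cong: measurable_cong_sets)
  qed
  have bound: "\<bar>X k J\<bar> \<le> 1" for k J
    using p by (auto simp: X_def rule_prob_def)
  have orth: "expectation (\<lambda>J. X i J * X j J) = 0" if ij: "i < j" for i j
  proof -
    \<comment> \<open>Where the indicator of the later window is 1, the constant \<open>?q\<close>
      equals \<open>right_prob\<close> at \<open>j + N\<close>.\<close>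
    have eq: "X i J * X j J = (X i J * of_bool (map J [j..<j + N] = v)) *
        (of_bool (J (j + N)) - right_prob N M p0 p1 (j + N) J)" for J
      by (auto simp: X_def right_prob_window)
    \<comment> \<open>The latest jump in the earlier factor has index \<open>i + N\<close>, and
      \<open>i < j\<close> keeps it strictly before \<open>j + N\<close>.\<close>
    have dep: "X i J * of_bool (map J [j..<j + N] = v) = X i J' * of_bool (map J' [j..<j + N] = v)"
      if "\<And>k. k < j + N \<Longrightarrow> J k = J' k" for J J'
    proof -
      have "map J [i..<i + N] = map J' [i..<i + N]" "map J [j..<j + N] = map J' [j..<j + N]"
        "J (i + N) = J' (i + N)"
        using that ij by auto
      then show ?thesis by (simp only: X_def)
    qed
    show ?thesis
      unfolding eq by (rule expectation_centred_jump[OF p dep])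
  qed
  show ?thesis
    using bounded_orthogonal_averages_tendsto_0[of X, OF meas bound orth] unfolding X_def by blast
qed

section \<open>Convergence of the window frequencies\<close>

text \<open>
  This factor is forced by the balance equation \<open>win_weight_balance\<close> between \<open>M - 1\<close> and \<open>M\<close>.
\<close>

definition cut_weight :: "nat \<Rightarrow> nat \<Rightarrow> real \<Rightarrow> real \<Rightarrow> real" where
  "cut_weight N M p0 p1 =
    (1 - p0) / (1 - p1) * (p0 * (1 - p1) / (p1 * (1 - p0))) ^ M * ((1 - p0) / (1 - p1)) ^ N"

definition win_weight :: "nat \<Rightarrow> nat \<Rightarrow> real \<Rightarrow> real \<Rightarrow> nat \<Rightarrow> real" where
  "win_weight N M p0 p1 k =
    (if k < M then p0 ^ k * (1 - p0) ^ (N - k)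
     else cut_weight N M p0 p1 * (p1 ^ k * (1 - p1) ^ (N - k)))"

lemma cut_weight_pos:
  assumes "0 < p0" "p0 < 1" "0 < p1" "p1 < 1"
  shows "0 < cut_weight N M p0 p1"
  using assms by (simp add: cut_weight_def)

lemma win_weight_pos:
  assumes "0 < p0" "p0 < 1" "0 < p1" "p1 < 1"
  shows "0 < win_weight N M p0 p1 k"
  using assms cut_weight_pos[OF assms] by (simp add: win_weight_def)

text \<open>For a weight that depends only on the number of right jumps, this is the whole
  stationarity equation: of the two predecessors of a window, one has the same count as the window
  itself. On either side of the threshold it is immediate from the product form.\<close>

lemma win_weight_balance:
  assumes p: "0 < p0" "p0 < 1" "0 < p1" "p1 < 1" and k: "k < N" and M: "M \<le> N"
  shows "win_weight N M p0 p1 (Suc k) * (1 - rule_prob M p0 p1 (Suc k)) =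
    win_weight N M p0 p1 k * rule_prob M p0 p1 k"
proof -
  have split: "x ^ (N - k) = x ^ (N - Suc k) * x" for x :: real
    using k by (simp flip: power_Suc2 add: Suc_diff_Suc)
  consider "Suc k < M" | "M = Suc k" | "M \<le> k" by linarith
  then show ?thesis
  proof cases
    \<comment> \<open>The step across the threshold. One part of \<open>cut_weight\<close> turns the
      powers of \<open>p1\<close> into powers of \<open>p0\<close>, the remaining part turns the
      powers of \<open>1 - p1\<close> into powers of \<open>1 - p0\<close>.\<close>
    case 2
    obtain d where N: "N = Suc k + d" using k by (auto dest: less_imp_Suc_add)
    define a where "a = 1 - p0"
    define b where "b = 1 - p1"
    have ab: "0 < a" "0 < b" using p by (simp_all add: a_def b_def)
    have "(p0 * b / (p1 * a)) ^ Suc k * (a / b) ^ Suc k * p1 ^ Suc k = p0 ^ Suc k"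
      using ab p by (simp only: power_mult_distrib [symmetric]) simp
    moreover have "a / b * (a / b) ^ d * b ^ d * b = a ^ Suc d"
      using ab by (simp add: power_divide)
    ultimately have "((p0 * b / (p1 * a)) ^ Suc k * (a / b) ^ Suc k * p1 ^ Suc k) *
        (a / b * (a / b) ^ d * b ^ d * b) = p0 ^ Suc k * a ^ Suc d"
      by (simp only:)
    moreover have "win_weight N M p0 p1 (Suc k) * (1 - rule_prob M p0 p1 (Suc k)) =
        ((p0 * b / (p1 * a)) ^ Suc k * (a / b) ^ Suc k * p1 ^ Suc k) * (a / b * (a / b) ^ d * b ^ d * b)"
      by (simp only: win_weight_def rule_prob_def cut_weight_def 2 N power_add a_def b_def)
        (simp del: power_Suc times_divide_eq_left times_divide_eq_right)
    moreover have "win_weight N M p0 p1 k * rule_prob M p0 p1 k = p0 ^ Suc k * a ^ Suc d"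
      by (simp add: win_weight_def rule_prob_def 2 N a_def)
    ultimately show ?thesis by (simp only:)
  qed (use p in \<open>simp_all add: win_weight_def rule_prob_def split\<close>)
qed

lemma tendsto_bounded_over_n:
  fixes f :: "nat \<Rightarrow> real"
  assumes "\<And>n. \<bar>f n\<bar> \<le> C"
  shows "(\<lambda>n. f n / real n) \<longlonglongrightarrow> 0"
proof (rule Lim_null_comparison)
  show "\<forall>\<^sub>F n in sequentially. norm (f n / real n) \<le> C * inverse (real n)"
    using assms by (auto simp: divide_inverse abs_mult intro!: always_eventually mult_right_mono)
  show "(\<lambda>n. C * inverse (real n)) \<longlonglongrightarrow> 0"
    using tendsto_mult[OF tendsto_const lim_inverse_n, of C] by simp
qed

text \<open>A deterministic statement about a single jump sequence satisfying \<open>A0\<close>. The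
  ratios \<open>h\<close> of frequency to stationary weight become nearly constant by
  \<open>oscillation_bound\<close>, and normalisation forces the constant to be 1.\<close>

lemma window_frequencies:
  fixes J :: "nat \<Rightarrow> bool" and N M :: nat and p0 p1 :: real
  defines "c \<equiv> \<lambda>n v. (\<Sum>k<n. of_bool (map J [k..<k + N] = v)) / real n"
  assumes p: "0 < p0" "p0 < 1" "0 < p1" "p1 < 1" and MN: "1 \<le> N" "M \<le> N"
    and A0: "\<And>v. length v = N \<Longrightarrow> (\<lambda>n. (\<Sum>k<n. of_bool (map J [k..<k + N] = v) *
      (of_bool (J (k + N)) - rule_prob M p0 p1 (count_list v True))) / real n) \<longlonglongrightarrow> 0"
    and v: "length v = N"
  shows "(\<lambda>n. c n v) \<longlonglongrightarrow> win_weight N M p0 p1 (count_list v True) /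
    (\<Sum>u | length u = N. win_weight N M p0 p1 (count_list u True))"
proof -
  define W where "W k = map J [k..<k + N]" for k
  define q where "q v = rule_prob M p0 p1 (count_list v True)" for v
  define Z where "Z = (\<Sum>u | length u = N. win_weight N M p0 p1 (count_list u True))"
  define \<pi> where "\<pi> v = win_weight N M p0 p1 (count_list v True) / Z" for v
  define A where "A n v = (\<Sum>k<n. of_bool (W k = v) * (of_bool (J (k + N)) - q v)) / real n" for n v
  \<comment> \<open>The boundary term left over when the sum over window positions is shifted by
    one.\<close>
  define bd :: "nat \<Rightarrow> bool list \<Rightarrow> real" where
    "bd n v = (of_bool (W 0 = v) - of_bool (W n = v)) / real n" for n v
  \<comment> \<open>The frequencies satisfy the forward equation, whose coefficients into a given
    window need not sum to 1. After division by \<open>\<pi>\<close> they do, and averaging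
    arguments apply.\<close>
  define h where "h n v = c n v / \<pi> v" for n v
  define err where
    "err n v = h n v - (q v * h n (True # butlast v) + (1 - q v) * h n (False # butlast v))" for n v
  define e where "e n = (\<Sum>v | length v = N. \<bar>err n v\<bar>)" for n
  define \<delta> where "\<delta> = min (min p0 (1 - p0)) (min p1 (1 - p1))"

  have Z: "0 < Z"
    unfolding Z_def using v by (intro sum_pos win_weight_pos p) auto
  have \<pi>_pos: "0 < \<pi> v" for v unfolding \<pi>_def using Z win_weight_pos[OF p] by simp
  have \<pi>_sum: "(\<Sum>v | length v = N. \<pi> v) = 1"
    unfolding \<pi>_def using Z by (simp add: Z_def flip: sum_divide_distrib)
  have A_lim: "(\<lambda>n. A n v) \<longlonglongrightarrow> 0" if "length v = N" for v
    using A0[OF that] by (simp add: A_def W_def q_def)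
  have bd_lim: "(\<lambda>n. bd n v) \<longlonglongrightarrow> 0" for v
    unfolding bd_def by (rule tendsto_bounded_over_n[of _ 1]) auto
  have balance: "\<pi> (xs @ [True]) * (1 - q (xs @ [True])) = \<pi> (False # xs) * q (False # xs)"
    "\<pi> (True # xs) = \<pi> (xs @ [True])" "\<pi> (xs @ [False]) = \<pi> (False # xs)"
    "q (True # xs) = q (xs @ [True])" "q (xs @ [False]) = q (False # xs)"
    if "length xs < N" for xs
  proof -
    have "count_list xs True < N" using count_le_length[of xs True] that by simp
    from win_weight_balance[OF p this MN(2)]
    show "\<pi> (xs @ [True]) * (1 - q (xs @ [True])) = \<pi> (False # xs) * q (False # xs)"
      by (simp add: \<pi>_def q_def)
  qed (simp_all add: \<pi>_def q_def)
  have W_Suc: "W (Suc k) = xs @ [y] \<longleftrightarrow> (W k = True # xs \<or> W k = False # xs) \<and> J (k + N) = y" for k xs y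
  proof -
    have "W k = J k # map J [Suc k..<k + N]" using MN by (simp add: W_def upt_conv_Cons)
    moreover have "W (Suc k) = map J [Suc k..<k + N] @ [J (k + N)]" using MN by (simp add: W_def)
    ultimately show ?thesis by auto
  qed
  have c_shift: "c n v = (\<Sum>k<n. of_bool (W (Suc k) = v)) / real n + bd n v" for n v
  proof -
    have "(\<Sum>k<n. of_bool (W k = v)) =
        (\<Sum>k<n. of_bool (W (Suc k) = v)) + (of_bool (W 0 = v) - of_bool (W n = v) :: real)"
      by (induction n) auto
    then show ?thesis by (simp add: c_def W_def bd_def add_divide_distrib)
  qed
  \<comment> \<open>The cases \<open>y = True\<close> and \<open>y = False\<close> differ only in the sign and in \<open>q\<close> versus \<open>1 - q\<close>.\<close>
  have c_step: "c n (xs @ [y]) = sgn_y * (A n (True # xs) + A n (False # xs)) + bd n (xs @ [y]) +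
      (a (q (True # xs)) * c n (True # xs) + a (q (False # xs)) * c n (False # xs))"
    if "(y \<and> sgn_y = 1 \<and> a = (\<lambda>t. t)) \<or> (\<not> y \<and> sgn_y = -1 \<and> a = (\<lambda>t. 1 - t))"
    for n xs y and sgn_y :: real and a :: "real \<Rightarrow> real"
  proof -
    have "(\<Sum>k<n. of_bool (W (Suc k) = xs @ [y])) =
      (\<Sum>k<n. sgn_y * (of_bool (W k = True # xs) * (of_bool (J (k + N)) - q (True # xs)) +
          of_bool (W k = False # xs) * (of_bool (J (k + N)) - q (False # xs))) +
        (a (q (True # xs)) * of_bool (W k = True # xs) + a (q (False # xs)) * of_bool (W k = False # xs)))"
      using that by (intro sum.cong refl) (auto simp: W_Suc)
    also have "\<dots> = sgn_y * ((\<Sum>k<n. of_bool (W k = True # xs) * (of_bool (J (k + N)) - q (True # xs))) +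
          (\<Sum>k<n. of_bool (W k = False # xs) * (of_bool (J (k + N)) - q (False # xs)))) +
        (a (q (True # xs)) * (\<Sum>k<n. of_bool (W k = True # xs)) +
         a (q (False # xs)) * (\<Sum>k<n. of_bool (W k = False # xs)))"
      by (simp only: sum.distrib flip: sum_distrib_left)
    finally show ?thesis
      by (simp only: c_shift[of n "xs @ [y]"])
        (simp add: A_def c_def W_def add_divide_distrib algebra_simps)
  qed
  have err_lim: "(\<lambda>n. err n v) \<longlonglongrightarrow> 0" if len_v: "length v = N" for v
  proof -
    obtain xs y where vxs: "v = xs @ [y]" using len_v MN by (cases v rule: rev_cases) auto
    have len: "length (True # xs) = N" "length (False # xs) = N" "length xs < N"
      using len_v vxs by auto
    note b = balance[OF len(3)]
    have pos: "\<pi> (xs @ [True]) > 0" "\<pi> (False # xs) > 0" by (rule \<pi>_pos)+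
    define s :: real where "s = (if y then 1 else -1)"
    \<comment> \<open>The balance equation converts the forward coefficients \<open>q\<close> or
      \<open>1 - q\<close> of the two predecessors into the backward weights \<open>q v\<close> and
      \<open>1 - q v\<close>. Only martingale averages and the boundary term survive.\<close>
    have "err n v = (s * (A n (True # xs) + A n (False # xs)) + bd n v) / \<pi> v" for n
    proof (cases y)
      case True
      have "(1 - q (xs @ [True])) / \<pi> (False # xs) = q (False # xs) / \<pi> (xs @ [True])"
        using b(1) pos by (simp add: field_simps)
      then have "c n (False # xs) * ((1 - q (xs @ [True])) / \<pi> (False # xs)) =
          c n (False # xs) * (q (False # xs) / \<pi> (xs @ [True]))"
        by (simp only:)
      then have "(1 - q v) * h n (False # xs) = q (False # xs) * c n (False # xs) / \<pi> v"
        by (simp add: vxs True h_def mult.commute)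
      moreover have "q v * h n (True # xs) = q (True # xs) * c n (True # xs) / \<pi> v"
        using b by (simp add: vxs True h_def)
      moreover have "h n v = (s * (A n (True # xs) + A n (False # xs)) + bd n v +
          (q (True # xs) * c n (True # xs) + q (False # xs) * c n (False # xs))) / \<pi> v"
        unfolding h_def using c_step[of y s "\<lambda>t. t" n xs] by (simp add: True s_def vxs)
      ultimately show ?thesis by (simp add: err_def vxs add_divide_distrib)
    next
      case False
      have "q (False # xs) / \<pi> (True # xs) = (1 - q (True # xs)) / \<pi> (False # xs)"
        using b pos by (simp add: field_simps)
      then have "c n (True # xs) * (q (False # xs) / \<pi> (True # xs)) =
          c n (True # xs) * ((1 - q (True # xs)) / \<pi> (False # xs))"
        by (simp only:)
      then have "q v * h n (True # xs) = (1 - q (True # xs)) * c n (True # xs) / \<pi> v"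
        using b(3,5) by (simp add: vxs False h_def mult.commute)
      moreover have "(1 - q v) * h n (False # xs) = (1 - q (False # xs)) * c n (False # xs) / \<pi> v"
        using b by (simp add: vxs False h_def)
      moreover have "h n v = (s * (A n (True # xs) + A n (False # xs)) + bd n v +
          ((1 - q (True # xs)) * c n (True # xs) + (1 - q (False # xs)) * c n (False # xs))) / \<pi> v"
        unfolding h_def using c_step[of y s "\<lambda>t. 1 - t" n xs] by (simp add: False s_def vxs)
      ultimately show ?thesis by (simp add: err_def vxs add_divide_distrib)
    qed
    moreover have "(\<lambda>n. (s * (A n (True # xs) + A n (False # xs)) + bd n v) / \<pi> v)
        \<longlonglongrightarrow> (s * (0 + 0) + 0) / \<pi> v"
      using \<pi>_pos[of v] by (intro tendsto_intros A_lim bd_lim len) simp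
    ultimately show ?thesis by simp
  qed
  have e_lim: "e \<longlonglongrightarrow> 0"
  proof -
    have "e \<longlonglongrightarrow> (\<Sum>v :: bool list | length v = N. \<bar>0\<bar>)"
      unfolding e_def by (intro tendsto_sum tendsto_rabs err_lim) simp
    then show ?thesis by simp
  qed
  have osc: "\<bar>h n v - h n u\<bar> \<le> real N * e n / \<delta> ^ N" if "length u = N" for n u
  proof (rule oscillation_bound[of \<delta> q])
    show "0 < \<delta>" "\<delta> \<le> q w" "q w \<le> 1 - \<delta>" for w
      using p by (auto simp: \<delta>_def q_def rule_prob_def)
    show "0 \<le> e n" by (simp add: e_def sum_nonneg)
    fix xs :: "bool list" and y assume "length (xs @ [y]) = N"
    then have "\<bar>err n (xs @ [y])\<bar> \<le> e n"
      unfolding e_def by (intro member_le_sum) auto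
    then show "\<bar>h n (xs @ [y]) - (q (xs @ [y]) * h n (True # xs) +
        (1 - q (xs @ [y])) * h n (False # xs))\<bar> \<le> e n"
      by (simp add: err_def)
  qed (use that v in auto)
  have "(\<lambda>n. h n v - 1) \<longlonglongrightarrow> 0"
  proof (rule Lim_null_comparison)
    show "\<forall>\<^sub>F n in sequentially. norm (h n v - 1) \<le> real N * e n / \<delta> ^ N"
      using eventually_gt_at_top[of 0]
    proof eventually_elim
      case (elim n)
      have "(\<Sum>u | length u = N. \<pi> u * h n u) = (\<Sum>u | length u = N. c n u)"
        using \<pi>_pos by (intro sum.cong refl) (simp add: h_def less_imp_neq[THEN not_sym])
      also have "\<dots> = (\<Sum>k<n. \<Sum>u | length u = N. of_bool (map J [k..<k + N] = u)) / real n"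
        unfolding c_def sum_divide_distrib[symmetric] by (subst sum.swap) simp
      also have "\<dots> = (\<Sum>k<n. 1) / real n"
        by (intro arg_cong2[where f = "(/)"] sum.cong refl) (simp add: of_bool_def)
      also have "\<dots> = 1" using elim by simp
      \<comment> \<open>Since \<open>\<pi>\<close> has total mass 1 and \<open>h n\<close> has
        \<open>\<pi>\<close>-mean 1, the deviation from 1 is a \<open>\<pi>\<close>-average of
        differences of \<open>h n\<close>.\<close>
      finally have "h n v - 1 = (\<Sum>u | length u = N. \<pi> u * (h n v - h n u))"
        using \<pi>_sum by (simp add: right_diff_distrib sum_subtractf flip: sum_distrib_right)
      also have "norm \<dots> \<le> (\<Sum>u | length u = N. \<pi> u * (real N * e n / \<delta> ^ N))"
      proof (rule sum_norm_le)
        fix u :: "bool list" assume "u \<in> {u. length u = N}"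
        then show "norm (\<pi> u * (h n v - h n u)) \<le> \<pi> u * (real N * e n / \<delta> ^ N)"
          using mult_left_mono[OF osc[of u n] less_imp_le[OF \<pi>_pos[of u]]]
          by (simp add: abs_mult abs_of_pos[OF \<pi>_pos])
      qed
      also have "\<dots> = real N * e n / \<delta> ^ N"
        by (simp only: \<pi>_sum mult_1_left flip: sum_distrib_right)
      finally show ?case .
    qed
    show "(\<lambda>n. real N * e n / \<delta> ^ N) \<longlonglongrightarrow> 0"
    proof -
      have "(\<lambda>n. real N * e n / \<delta> ^ N) \<longlonglongrightarrow> real N * 0 / \<delta> ^ N"
        using p by (intro tendsto_intros e_lim) (simp add: \<delta>_def)
      then show ?thesis by simp
    qed
  qed
  then have "(\<lambda>n. \<pi> v * (h n v - 1) + \<pi> v) \<longlonglongrightarrow> \<pi> v * 0 + \<pi> v"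
    by (intro tendsto_intros)
  moreover have "\<pi> v * (h n v - 1) + \<pi> v = c n v" for n
    using \<pi>_pos[of v] by (simp add: h_def field_simps)
  ultimately show ?thesis by (simp add: \<pi>_def Z_def)
qed

section \<open>The stationary density of right jumps\<close>

definition right_density :: "nat \<Rightarrow> nat \<Rightarrow> real \<Rightarrow> real \<Rightarrow> real" where
  "right_density N M p0 p1 =
    (\<Sum>v | length v = N. win_weight N M p0 p1 (count_list v True) * rule_prob M p0 p1 (count_list v True)) /
    (\<Sum>v | length v = N. win_weight N M p0 p1 (count_list v True))"

text \<open>Grouping windows by their number of right jumps turns the sum below the threshold into a
  tail of the binomial law with \<open>p0\<close>, and the sum above it into \<open>c\<close> times
  a tail of the law with \<open>p1\<close>.\<close>

lemma right_density_eq: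
  assumes p: "0 < p0" "p0 < 1" "0 < p1" "p1 < 1" and M: "M \<le> N"
  defines "a \<equiv> measure_pmf.prob (binomial_pmf N p0) {..<M}"
    and "b \<equiv> measure_pmf.prob (binomial_pmf N p1) {M..}"
    and "c \<equiv> cut_weight N M p0 p1"
  shows "right_density N M p0 p1 = (p0 * a + p1 * (c * b)) / (a + c * b)"
proof -
  have a: "a = (\<Sum>k<M. real (N choose k) * p0 ^ k * (1 - p0) ^ (N - k))"
    unfolding a_def using p M by (simp add: measure_measure_pmf_finite)
  have b: "b = (\<Sum>k\<in>{M..N}. real (N choose k) * p1 ^ k * (1 - p1) ^ (N - k))"
  proof -
    \<comment> \<open>The infinite set \<open>{M..}\<close> is cut down to the support, so that the
      probability becomes a finite sum.\<close>
    have "b = measure_pmf.prob (binomial_pmf N p1) ({M..} \<inter> set_pmf (binomial_pmf N p1))"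
      by (simp add: b_def measure_Int_set_pmf)
    also have "{M..} \<inter> set_pmf (binomial_pmf N p1) = {M..N}"
      using p by auto
    finally show ?thesis using p by (simp add: measure_measure_pmf_finite)
  qed
  have split: "(\<Sum>v | length v = N. F (count_list v True)) =
      (\<Sum>k<M. real (N choose k) * F k) + (\<Sum>k\<in>{M..N}. real (N choose k) * F k)" for F :: "nat \<Rightarrow> real"
  proof -
    have "{..N} = {..<M} \<union> {M..N}" using M by auto
    then show ?thesis
      unfolding sum_lists_count by (simp only:) (rule sum.union_disjoint, auto)
  qed
  have low: "(\<Sum>k<M. real (N choose k) * F k) = f * a"
    if "\<And>k. k < M \<Longrightarrow> F k = f * (p0 ^ k * (1 - p0) ^ (N - k))" for F :: "nat \<Rightarrow> real" and f
    unfolding a sum_distrib_left by (intro sum.cong refl) (simp add: that)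
  have high: "(\<Sum>k\<in>{M..N}. real (N choose k) * F k) = f * b"
    if "\<And>k. M \<le> k \<Longrightarrow> F k = f * (p1 ^ k * (1 - p1) ^ (N - k))" for F :: "nat \<Rightarrow> real" and f
    unfolding b sum_distrib_left by (intro sum.cong refl) (simp add: that)
  have "(\<Sum>v | length v = N. win_weight N M p0 p1 (count_list v True)) = 1 * a + c * b"
    unfolding split[of "win_weight N M p0 p1"]
    by (subst low[of _ 1]; (subst high[of _ c])?) (simp_all add: win_weight_def c_def)
  moreover have "(\<Sum>v | length v = N. win_weight N M p0 p1 (count_list v True) *
      rule_prob M p0 p1 (count_list v True)) = p0 * a + p1 * c * b"
    unfolding split[of "\<lambda>k. win_weight N M p0 p1 k * rule_prob M p0 p1 k"]
    by (subst low[of _ p0]; (subst high[of _ "p1 * c"])?) (simp_all add: win_weight_def rule_prob_def c_def)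
  ultimately show ?thesis by (simp add: right_density_def mult.assoc)
qed

section \<open>Concentration of the binomial law\<close>

text \<open>With \<open>\<epsilon>\<close> half the gap between \<open>p\<close> and
  \<open>r\<close>, eventually \<open>M N / N\<close> exceeds \<open>p + \<epsilon>\<close>, and
  Hoeffding's inequality bounds the complement by an exponentially small term.\<close>

lemma binomial_lower_tail_tendsto_1:
  assumes p: "0 \<le> p" "p \<le> 1" and lim: "(\<lambda>N. real (M N) / real N) \<longlonglongrightarrow> r" and "p < r"
  shows "(\<lambda>N. measure_pmf.prob (binomial_pmf N p) {..<M N}) \<longlonglongrightarrow> 1"
proof -
  interpret binomial_distribution n p for n by unfold_locales (use p in auto)
  define \<epsilon> where "\<epsilon> = (r - p) / 2"
  have \<epsilon>: "0 < \<epsilon>" "p + \<epsilon> < r" using \<open>p < r\<close> by (auto simp: \<epsilon>_def field_simps)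
  show ?thesis
  proof (rule tendsto_sandwich[where h = "\<lambda>_. 1"])
    show "\<forall>\<^sub>F N in sequentially. 1 - exp (- 2 * real N * \<epsilon>\<^sup>2) \<le>
        measure_pmf.prob (binomial_pmf N p) {..<M N}"
      using order_tendstoD(1)[OF lim \<epsilon>(2)] eventually_gt_at_top[of 0]
    proof eventually_elim
      case (elim N)
      have "1 - exp (- 2 * real N * \<epsilon>\<^sup>2) \<le>
          1 - measure_pmf.prob (binomial_pmf N p) {x. real x / real N \<ge> p + \<epsilon>}"
        using prob_ge'[of N \<epsilon>] elim \<epsilon> by simp
      also have "\<dots> = measure_pmf.prob (binomial_pmf N p) (- {x. real x / real N \<ge> p + \<epsilon>})"
        using measure_pmf.prob_compl[of "{x. real x / real N \<ge> p + \<epsilon>}" "binomial_pmf N p"]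
        by (simp add: Compl_eq_Diff_UNIV)
      also have "\<dots> \<le> measure_pmf.prob (binomial_pmf N p) {..<M N}"
      proof (rule measure_pmf.finite_measure_mono)
        show "- {x. real x / real N \<ge> p + \<epsilon>} \<subseteq> {..<M N}"
        proof
          fix x assume "x \<in> - {x. real x / real N \<ge> p + \<epsilon>}"
          then have "real x / real N < real (M N) / real N" using elim by simp
          then show "x \<in> {..<M N}" using elim by (simp add: divide_less_cancel)
        qed
      qed simp
      finally show ?case .
    qed
    show "(\<lambda>N. 1 - exp (- 2 * real N * \<epsilon>\<^sup>2)) \<longlonglongrightarrow> 1"
      using \<epsilon>(1) by real_asymp
  qed (auto intro!: always_eventually)
qed

lemma binomial_upper_tail_tendsto_1:
  assumes p: "0 \<le> p" "p \<le> 1" and lim: "(\<lambda>N. real (M N) / real N) \<longlonglongrightarrow> r" and "r < p"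
  shows "(\<lambda>N. measure_pmf.prob (binomial_pmf N p) {M N..}) \<longlonglongrightarrow> 1"
proof -
  interpret binomial_distribution n p for n by unfold_locales (use p in auto)
  define \<epsilon> where "\<epsilon> = (p - r) / 2"
  have \<epsilon>: "0 < \<epsilon>" "r < p - \<epsilon>" using \<open>r < p\<close> by (auto simp: \<epsilon>_def field_simps)
  show ?thesis
  proof (rule tendsto_sandwich[where h = "\<lambda>_. 1"])
    show "\<forall>\<^sub>F N in sequentially. 1 - exp (- 2 * real N * \<epsilon>\<^sup>2) \<le>
        measure_pmf.prob (binomial_pmf N p) {M N..}"
      using order_tendstoD(2)[OF lim \<epsilon>(2)] eventually_gt_at_top[of 0]
    proof eventually_elim
      case (elim N)
      have "1 - exp (- 2 * real N * \<epsilon>\<^sup>2) \<le>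
          1 - measure_pmf.prob (binomial_pmf N p) {x. real x / real N \<le> p - \<epsilon>}"
        using prob_le'[of N \<epsilon>] elim \<epsilon> by simp
      also have "\<dots> = measure_pmf.prob (binomial_pmf N p) (- {x. real x / real N \<le> p - \<epsilon>})"
        using measure_pmf.prob_compl[of "{x. real x / real N \<le> p - \<epsilon>}" "binomial_pmf N p"]
        by (simp add: Compl_eq_Diff_UNIV)
      also have "\<dots> \<le> measure_pmf.prob (binomial_pmf N p) {M N..}"
      proof (rule measure_pmf.finite_measure_mono)
        show "- {x. real x / real N \<le> p - \<epsilon>} \<subseteq> {M N..}"
        proof
          fix x assume "x \<in> - {x. real x / real N \<le> p - \<epsilon>}"
          then have "real (M N) / real N < real x / real N" using elim by simp
          then show "x \<in> {M N..}" using elim by (simp add: divide_less_cancel)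
        qed
      qed simp
      finally show ?case .
    qed
    show "(\<lambda>N. 1 - exp (- 2 * real N * \<epsilon>\<^sup>2)) \<longlonglongrightarrow> 1"
      using \<epsilon>(1) by real_asymp
  qed (auto intro!: always_eventually)
qed

text \<open>By the definition of \<open>r_star\<close>, the base raised to
  \<open>- r_star p0 p1\<close> is \<open>(1 - p0) / (1 - p1)\<close>. The two powers in
  \<open>cut_weight\<close> therefore merge into the one whose limit is \<alpha> in the
  theorem.\<close>

lemma cut_weight_powr:
  assumes "0 < p0" "p0 < p1" "p1 < 1"
  shows "cut_weight N M p0 p1 = (1 - p0) / (1 - p1) *
    (p0 * (1 - p1) / (p1 * (1 - p0))) powr (real M - real N * r_star p0 p1)"
proof -
  define c where "c = p0 * (1 - p1) / (p1 * (1 - p0))"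
  have c: "0 < c" using assms by (simp add: c_def)
  have inv: "p1 / p0 * ((1 - p0) / (1 - p1)) = inverse c"
    using assms by (simp add: c_def field_simps)
  have "r_star p0 p1 * ln c = - ln ((1 - p0) / (1 - p1))"
    using r_star_denominator_pos[OF assms] c unfolding r_star_def inv by (simp add: ln_inverse)
  then have "c powr (- r_star p0 p1) = (1 - p0) / (1 - p1)"
    using assms c by (simp add: powr_def)
  then have "((1 - p0) / (1 - p1)) ^ N = c powr (- (real N * r_star p0 p1))"
    using c by (metis mult.commute mult_minus_right powr_powr powr_realpow powr_gt_zero)
  moreover have "c ^ M = c powr real M" using c by (simp add: powr_realpow)
  ultimately have "c ^ M * ((1 - p0) / (1 - p1)) ^ N = c powr (real M + - (real N * r_star p0 p1))"
    by (simp only: powr_add)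
  then show ?thesis by (simp add: cut_weight_def flip: c_def mult.assoc)
qed

text \<open>The second form divides numerator and denominator by \<open>c N\<close>, which allows
  \<open>c N\<close> to tend to infinity.\<close>

lemma right_density_tendsto:
  fixes M :: "nat \<Rightarrow> nat" and p0 p1 :: real
  defines "a \<equiv> \<lambda>N. measure_pmf.prob (binomial_pmf N p0) {..<M N}"
    and "b \<equiv> \<lambda>N. measure_pmf.prob (binomial_pmf N p1) {M N..}"
    and "c \<equiv> \<lambda>N. cut_weight N (M N) p0 p1"
  assumes p: "0 < p0" "p0 < 1" "0 < p1" "p1 < 1" and M: "\<forall>N\<ge>1. M N \<le> N"
  shows "a \<longlonglongrightarrow> 1 \<Longrightarrow> (\<lambda>N. c N * b N) \<longlonglongrightarrow> \<gamma> \<Longrightarrow> 0 \<le> \<gamma> \<Longrightarrow>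
      (\<lambda>N. right_density N (M N) p0 p1) \<longlonglongrightarrow> (p0 + p1 * \<gamma>) / (1 + \<gamma>)"
    and "(\<lambda>N. a N / c N) \<longlonglongrightarrow> 0 \<Longrightarrow> b \<longlonglongrightarrow> 1 \<Longrightarrow>
      (\<lambda>N. right_density N (M N) p0 p1) \<longlonglongrightarrow> p1"
proof -
  have eq: "\<forall>\<^sub>F N in sequentially.
      (p0 * a N + p1 * (c N * b N)) / (a N + c N * b N) = right_density N (M N) p0 p1"
    using eventually_ge_at_top[of 1]
    by eventually_elim (use M in \<open>simp add: right_density_eq[OF p] a_def b_def c_def\<close>)
  have c: "0 < c N" for N unfolding c_def by (rule cut_weight_pos[OF p])
  show "(\<lambda>N. right_density N (M N) p0 p1) \<longlonglongrightarrow> (p0 + p1 * \<gamma>) / (1 + \<gamma>)"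
    if "a \<longlonglongrightarrow> 1" "(\<lambda>N. c N * b N) \<longlonglongrightarrow> \<gamma>" "0 \<le> \<gamma>"
  proof -
    have "(\<lambda>N. (p0 * a N + p1 * (c N * b N)) / (a N + c N * b N)) \<longlonglongrightarrow>
        (p0 * 1 + p1 * \<gamma>) / (1 + \<gamma>)"
      using that by (intro tendsto_intros) auto
    then show ?thesis by (simp add: tendsto_cong[OF eq, symmetric])
  qed
  show "(\<lambda>N. right_density N (M N) p0 p1) \<longlonglongrightarrow> p1"
    if "(\<lambda>N. a N / c N) \<longlonglongrightarrow> 0" "b \<longlonglongrightarrow> 1"
  proof -
    have "(\<lambda>N. (p0 * (a N / c N) + p1 * b N) / (a N / c N + b N)) \<longlonglongrightarrow> (p0 * 0 + p1 * 1) / (0 + 1)"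
      using that by (intro tendsto_intros) auto
    moreover have "(p0 * (a N / c N) + p1 * b N) / (a N / c N + b N) =
        (p0 * a N + p1 * (c N * b N)) / (a N + c N * b N)" for N
    proof -
      have "p0 * (a N / c N) + p1 * b N = (p0 * a N + p1 * (c N * b N)) / c N"
        "a N / c N + b N = (a N + c N * b N) / c N"
        using c[of N] by (simp_all add: add_divide_distrib)
      then show ?thesis using c[of N] by simp
    qed
    ultimately show ?thesis by (simp add: tendsto_cong[OF eq, symmetric])
  qed
qed

section \<open>Limits of the density below, above and at the critical ratio\<close>

lemma tendsto_bounded_mult_0:
  fixes f g :: "nat \<Rightarrow> real"
  assumes "f \<longlonglongrightarrow> 0" "\<And>n. \<bar>g n\<bar> \<le> 1"
  shows "(\<lambda>n. f n * g n) \<longlonglongrightarrow> 0"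
proof (rule Lim_null_comparison)
  show "\<forall>\<^sub>F n in sequentially. norm (f n * g n) \<le> \<bar>f n\<bar>"
    using assms(2) by (auto simp: abs_mult mult_left_le intro!: always_eventually)
  show "(\<lambda>n. \<bar>f n\<bar>) \<longlonglongrightarrow> 0" using tendsto_rabs[OF assms(1)] by simp
qed

text \<open>Up to a constant factor \<open>x\<close> is the cut weight, and it is the exponential of
  \<open>N * (M N / N - r_star p0 p1)\<close> times a negative constant. It therefore explodes for
  \<open>r\<close> below the critical ratio and vanishes for \<open>r\<close> above it.\<close>

lemma right_density_limits:
  fixes M :: "nat \<Rightarrow> nat" and p0 p1 :: real
  defines "x \<equiv> \<lambda>N. (p0 * (1 - p1) / (p1 * (1 - p0))) powr (real (M N) - real N * r_star p0 p1)"
  assumes p: "0 < p0" "p0 < p1" "p1 < 1" and M: "\<forall>N\<ge>1. M N \<le> N"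
    and r: "(\<lambda>N. real (M N) / real N) \<longlonglongrightarrow> r"
  shows "r < r_star p0 p1 \<Longrightarrow> (\<lambda>N. right_density N (M N) p0 p1) \<longlonglongrightarrow> p1"
    and "r_star p0 p1 < r \<Longrightarrow> (\<lambda>N. right_density N (M N) p0 p1) \<longlonglongrightarrow> p0"
    and "r = r_star p0 p1 \<Longrightarrow> x \<longlonglongrightarrow> l \<Longrightarrow> (\<lambda>N. right_density N (M N) p0 p1) \<longlonglongrightarrow>
      (p0 * (1 - p1) + p1 * (1 - p0) * l) / (1 - p1 + (1 - p0) * l)"
    and "r = r_star p0 p1 \<Longrightarrow> filterlim x at_top sequentially \<Longrightarrow>
      (\<lambda>N. right_density N (M N) p0 p1) \<longlonglongrightarrow> p1"
proof -
  define base where "base = p0 * (1 - p1) / (p1 * (1 - p0))"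
  define K where "K = (1 - p0) / (1 - p1)"
  have K: "0 < K" using p by (simp add: K_def)
  have base: "0 < base" "base < 1" using p by (simp_all add: base_def field_simps)
  have p': "0 < p0" "p0 < 1" "0 < p1" "p1 < 1" using p by auto
  note lim = right_density_tendsto[OF p' M]
  note stars = r_star_bounds[OF p]
  have cut: "cut_weight N (M N) p0 p1 = K * x N" for N
    using cut_weight_powr[OF p] by (simp add: x_def K_def)
  have x_pos: "0 < x N" for N using p' by (simp add: x_def)
  \<comment> \<open>At \<open>N = 0\<close> the quotient is 0 by convention and the identity can
    fail.\<close>
  have x_eq: "x N = exp (ln base * (real N * (real (M N) / real N - r_star p0 p1)))" if "0 < N" for N
    using p' that by (simp add: x_def powr_def base_def right_diff_distrib mult.commute)
  have lnb: "ln base < 0" using base by simp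
  \<comment> \<open>This includes \<open>r < p0\<close>, where the lower tail probability does not
    tend to 1; being at most 1, it vanishes after division by \<open>x N\<close>.\<close>
  have big: "(\<lambda>N. right_density N (M N) p0 p1) \<longlonglongrightarrow> p1"
    if "filterlim x at_top sequentially" "r < p1"
  proof (rule lim(2))
    have "(\<lambda>N. inverse (x N)) \<longlonglongrightarrow> 0"
      using that(1) by (rule tendsto_inverse_0_at_top)
    then have "(\<lambda>N. inverse (x N) * measure_pmf.prob (binomial_pmf N p0) {..<M N}) \<longlonglongrightarrow> 0"
      by (rule tendsto_bounded_mult_0) simp
    from tendsto_mult_right[OF this, of "inverse K"]
    show "(\<lambda>N. measure_pmf.prob (binomial_pmf N p0) {..<M N} / cut_weight N (M N) p0 p1) \<longlonglongrightarrow> 0"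
      by (simp add: cut field_simps)
    show "(\<lambda>N. measure_pmf.prob (binomial_pmf N p1) {M N..}) \<longlonglongrightarrow> 1"
      by (rule binomial_upper_tail_tendsto_1[OF _ _ r that(2)]) (use p' in auto)
  qed
  have lower: "(\<lambda>N. measure_pmf.prob (binomial_pmf N p0) {..<M N}) \<longlonglongrightarrow> 1" if "p0 < r"
    by (rule binomial_lower_tail_tendsto_1[OF _ _ r that]) (use p' in auto)
  show "(\<lambda>N. right_density N (M N) p0 p1) \<longlonglongrightarrow> p1" if "r < r_star p0 p1"
  proof (rule big)
    have "(\<lambda>N. ln base * (real (M N) / real N - r_star p0 p1)) \<longlonglongrightarrow> ln base * (r - r_star p0 p1)"
      by (intro tendsto_intros r)
    moreover have "0 < ln base * (r - r_star p0 p1)" using lnb that by (simp add: mult_neg_neg)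
    ultimately have "filterlim (\<lambda>N. ln base * (real (M N) / real N - r_star p0 p1) * real N) at_top sequentially"
      by (rule filterlim_tendsto_pos_mult_at_top[OF _ _ filterlim_real_sequentially])
    then have "filterlim (\<lambda>N. exp (ln base * (real (M N) / real N - r_star p0 p1) * real N)) at_top sequentially"
      by (rule filterlim_compose[OF exp_at_top])
    then show "filterlim x at_top sequentially"
      by (rule filterlim_mono_eventually[OF _ order_refl order_refl])
        (use eventually_gt_at_top[of 0] in eventually_elim, simp add: x_eq mult_ac)
  qed (use that stars in simp)
  show "(\<lambda>N. right_density N (M N) p0 p1) \<longlonglongrightarrow> p0" if "r_star p0 p1 < r"
  proof -
    have "(\<lambda>N. - ln base * (real (M N) / real N - r_star p0 p1)) \<longlonglongrightarrow> - ln base * (r - r_star p0 p1)"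
      by (intro tendsto_intros r)
    moreover have "0 < - ln base * (r - r_star p0 p1)" using lnb that by (simp add: mult_neg_pos)
    ultimately have "filterlim (\<lambda>N. - ln base * (real (M N) / real N - r_star p0 p1) * real N) at_top sequentially"
      by (rule filterlim_tendsto_pos_mult_at_top[OF _ _ filterlim_real_sequentially])
    then have "filterlim (\<lambda>N. - (- ln base * (real (M N) / real N - r_star p0 p1) * real N)) at_bot sequentially"
      by (simp only: filterlim_uminus_at_top)
    then have "(\<lambda>N. exp (- (- ln base * (real (M N) / real N - r_star p0 p1) * real N))) \<longlonglongrightarrow> 0"
      by (rule filterlim_compose[OF exp_at_bot])
    then have "x \<longlonglongrightarrow> 0"
      by (rule filterlim_mono_eventually[OF _ order_refl order_refl])
        (use eventually_gt_at_top[of 0] in eventually_elim, simp add: x_eq mult_ac)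
    \<comment> \<open>Here \<open>r\<close> may exceed \<open>p1\<close>, so the upper tail is only
      bounded by 1; the factor \<open>x N\<close> makes the product vanish.\<close>
    then have "(\<lambda>N. x N * measure_pmf.prob (binomial_pmf N p1) {M N..}) \<longlonglongrightarrow> 0"
      by (rule tendsto_bounded_mult_0) simp
    from tendsto_mult_right[OF this, of K]
    have "(\<lambda>N. cut_weight N (M N) p0 p1 * measure_pmf.prob (binomial_pmf N p1) {M N..}) \<longlonglongrightarrow> 0"
      by (simp add: cut mult_ac)
    from lim(1)[OF lower this] show ?thesis using that stars by simp
  qed
  show "(\<lambda>N. right_density N (M N) p0 p1) \<longlonglongrightarrow> p1"
    if "r = r_star p0 p1" "filterlim x at_top sequentially"
    using big that stars by simp
  show "(\<lambda>N. right_density N (M N) p0 p1) \<longlonglongrightarrow>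
      (p0 * (1 - p1) + p1 * (1 - p0) * l) / (1 - p1 + (1 - p0) * l)"
    if "r = r_star p0 p1" "x \<longlonglongrightarrow> l"
  proof -
    have l: "0 \<le> l" using that(2) x_pos by (intro LIMSEQ_le_const[OF that(2)]) (auto intro: less_imp_le)
    have "(\<lambda>N. measure_pmf.prob (binomial_pmf N p1) {M N..}) \<longlonglongrightarrow> 1"
      by (rule binomial_upper_tail_tendsto_1[OF _ _ r]) (use p' that stars in auto)
    then have "(\<lambda>N. cut_weight N (M N) p0 p1 * measure_pmf.prob (binomial_pmf N p1) {M N..}) \<longlonglongrightarrow> K * l * 1"
      unfolding cut by (intro tendsto_intros that)
    then have "(\<lambda>N. right_density N (M N) p0 p1) \<longlonglongrightarrow> (p0 + p1 * (K * l)) / (1 + K * l)"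
      using that stars l K by (intro lim(1) lower) auto
    moreover have "(p0 + p1 * (K * l)) / (1 + K * l) =
        (p0 * (1 - p1) + p1 * (1 - p0) * l) / (1 - p1 + (1 - p0) * l)"
    proof -
      have "p0 + p1 * (K * l) = (p0 * (1 - p1) + p1 * (1 - p0) * l) / (1 - p1)"
        "1 + K * l = (1 - p1 + (1 - p0) * l) / (1 - p1)"
        using p by (simp_all add: K_def add_divide_distrib)
      then show ?thesis using p by simp
    qed
    ultimately show ?thesis by simp
  qed
qed

section \<open>The speed\<close>

text \<open>Sorting the jumps by the window preceding them splits their average into the martingale
  averages, which vanish, and the window frequencies weighted with the probability of a right
  jump.\<close>

lemma right_averages:
  fixes J :: "nat \<Rightarrow> bool"
  assumes p: "0 < p0" "p0 < 1" "0 < p1" "p1 < 1" and MN: "1 \<le> N" "M \<le> N"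
    and A0: "\<And>v. length v = N \<Longrightarrow> (\<lambda>n. (\<Sum>k<n. of_bool (map J [k..<k + N] = v) *
      (of_bool (J (k + N)) - rule_prob M p0 p1 (count_list v True))) / real n) \<longlonglongrightarrow> 0"
  shows "(\<lambda>n. (\<Sum>k<n. of_bool (J k)) / real n) \<longlonglongrightarrow> right_density N M p0 p1"
proof -
  define q where "q v = rule_prob M p0 p1 (count_list v True)" for v
  define c where "c n v = (\<Sum>k<n. of_bool (map J [k..<k + N] = v)) / real n" for n v
  define A where "A n v = (\<Sum>k<n. of_bool (map J [k..<k + N] = v) * (of_bool (J (k + N)) - q v)) / real n" for n v
  define Z where "Z = (\<Sum>u | length u = N. win_weight N M p0 p1 (count_list u True))"
  have "(\<Sum>k<n. of_bool (J (k + N))) / real n = (\<Sum>v | length v = N. A n v + q v * c n v)" for n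
  proof -
    have one: "(\<Sum>v | length v = N. of_bool (map J [k..<k + N] = v)) = (1 :: real)" for k
      by (simp add: of_bool_def)
    have "(\<Sum>k<n. of_bool (J (k + N)) :: real) =
        (\<Sum>k<n. \<Sum>v | length v = N. of_bool (map J [k..<k + N] = v) * of_bool (J (k + N)))"
      by (simp only: one mult_1_left flip: sum_distrib_right)
    also have "\<dots> = (\<Sum>k<n. \<Sum>v | length v = N. of_bool (map J [k..<k + N] = v) * (of_bool (J (k + N)) - q v) +
        q v * of_bool (map J [k..<k + N] = v))"
      by (simp add: algebra_simps)
    also have "\<dots> = (\<Sum>v | length v = N. \<Sum>k<n. of_bool (map J [k..<k + N] = v) * (of_bool (J (k + N)) - q v) +
        q v * of_bool (map J [k..<k + N] = v))"
      by (rule sum.swap)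
    finally show ?thesis
      by (simp add: sum.distrib A_def c_def sum_divide_distrib add_divide_distrib flip: sum_distrib_left)
  qed
  moreover have "(\<lambda>n. \<Sum>v | length v = N. A n v + q v * c n v) \<longlonglongrightarrow>
      (\<Sum>v | length v = N. 0 + q v * (win_weight N M p0 p1 (count_list v True) / Z))"
    unfolding A_def c_def q_def Z_def
    by (intro tendsto_intros A0 window_frequencies[OF p MN A0]) auto
  moreover have "(\<Sum>v | length v = N. 0 + q v * (win_weight N M p0 p1 (count_list v True) / Z)) =
      right_density N M p0 p1"
    by (simp add: right_density_def Z_def q_def sum_divide_distrib mult.commute)
  ultimately have shifted: "(\<lambda>n. (\<Sum>k<n. of_bool (J (k + N))) / real n) \<longlonglongrightarrow> right_density N M p0 p1"
    by simp
  \<comment> \<open>The partial sums of the jumps and of their shift by \<open>N\<close> differ by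
    two blocks of \<open>N\<close> terms, a bounded amount that disappears after division by
    \<open>n\<close>.\<close>
  define d :: "nat \<Rightarrow> real" where "d n = (\<Sum>k<N. of_bool (J k)) - (\<Sum>k<N. of_bool (J (n + k)))" for n
  have d: "(\<Sum>k<n. of_bool (J k)) = (\<Sum>k<n. of_bool (J (k + N))) + d n" for n
  proof (induction n)
    case (Suc n)
    have "(\<Sum>k<N. of_bool (J (Suc n + k))) + of_bool (J n) =
        (\<Sum>k<N. of_bool (J (n + k))) + (of_bool (J (n + N)) :: real)"
      using sum.lessThan_Suc_shift[of "\<lambda>k. of_bool (J (n + k)) :: real" N] by simp
    then show ?case using Suc by (simp add: d_def)
  qed (simp add: d_def)
  have "\<bar>d n\<bar> \<le> real N" for n
  proof -
    have "0 \<le> (\<Sum>k<N. of_bool (J (m + k)) :: real)" "(\<Sum>k<N. of_bool (J (m + k)) :: real) \<le> real N" for m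
      using sum_mono[of "{..<N}" "\<lambda>k. of_bool (J (m + k)) :: real" "\<lambda>_. 1"]
      by (auto intro: sum_nonneg)
    from this[of 0] this[of n] show ?thesis by (auto simp: d_def)
  qed
  from tendsto_add[OF shifted tendsto_bounded_over_n[OF this]]
  show ?thesis by (simp add: d add_divide_distrib)
qed

lemma speed_eq:
  assumes p: "0 < p0" "p0 < 1" "0 < p1" "p1 < 1" and MN: "1 \<le> N" "M \<le> N"
  shows "speed x0 N M p0 p1 = 2 * right_density N M p0 p1 - 1"
proof -
  interpret prob_space "jump_law N M p0 p1" by (rule prob_space_jump_law)
  let ?s = "2 * right_density N M p0 p1 - 1"
  let ?P = "\<lambda>s. AE J in jump_law N M p0 p1. (\<lambda>n. real_of_int (walk x0 J n) / real n) \<longlonglongrightarrow> s"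
  \<comment> \<open>There are finitely many windows, so one null set serves for all of them.\<close>
  have "AE J in jump_law N M p0 p1. \<forall>v\<in>{v. length v = N}.
      (\<lambda>n. (\<Sum>k<n. of_bool (map J [k..<k + N] = v) *
        (of_bool (J (k + N)) - rule_prob M p0 p1 (count_list v True))) / real n) \<longlonglongrightarrow> 0"
    using p by (intro AE_finite_allI AE_window_averages) auto
  then have AE: "?P ?s"
  proof eventually_elim
    case (elim J)
    have walk: "real_of_int (walk x0 J n) = 2 * (\<Sum>k<n. of_bool (J k)) - real n + real_of_int x0" for n
      unfolding walk_def by (induction n) auto
    have "(\<lambda>n. 2 * ((\<Sum>k<n. of_bool (J k)) / real n) - 1 + real_of_int x0 / real n) \<longlonglongrightarrow> ?s + 0"
    proof (intro tendsto_add tendsto_diff tendsto_mult tendsto_const)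
      show "(\<lambda>n. (\<Sum>k<n. of_bool (J k)) / real n) \<longlonglongrightarrow> right_density N M p0 p1"
        by (rule right_averages[OF p MN]) (use elim in blast)
      show "(\<lambda>n. real_of_int x0 / real n) \<longlonglongrightarrow> 0"
        by (rule tendsto_bounded_over_n[of _ "\<bar>x0\<bar>"]) simp
    qed
    moreover have "\<forall>\<^sub>F n in sequentially. 2 * ((\<Sum>k<n. of_bool (J k)) / real n) - 1 + real_of_int x0 / real n =
        real_of_int (walk x0 J n) / real n"
      using eventually_gt_at_top[of 0]
      by eventually_elim (simp add: walk add_divide_distrib diff_divide_distrib)
    ultimately show ?case by (simp add: tendsto_cong)
  qed
  show ?thesis
    unfolding speed_def
  proof (rule the_equality)
    show "?P ?s" by (rule AE)
    fix s assume "?P s"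
    \<comment> \<open>A statement not involving \<open>J\<close> that holds almost surely in a
      probability space is true, which gives uniqueness of the limit.\<close>
    with AE have "AE J in jump_law N M p0 p1. s = ?s"
      by eventually_elim (rule LIMSEQ_unique)
    then show "s = ?s" by simp
  qed
qed

theorem theorem2:
  shows "(\<forall>p1\<in>{0<..<1}. strict_mono_on {0<..<p1} (\<lambda>p0. r_star p0 p1)) \<and>
    (\<forall>p0\<in>{0<..<1}. strict_mono_on {p0<..<1} (\<lambda>p1. r_star p0 p1)) \<and>
    (\<forall>p0 p1. 0 < p0 \<and> p0 < p1 \<and> p1 < 1 \<longrightarrow> p0 < r_star p0 p1 \<and> r_star p0 p1 < p1) \<and>
    (\<forall>(p0 :: real) (p1 :: real) (x0 :: int) (M :: nat \<Rightarrow> nat).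
      0 < p0 \<and> p0 < p1 \<and> p1 < 1 \<and> (\<forall>N\<ge>1. 1 \<le> M N \<and> M N \<le> N) \<longrightarrow>
        (\<forall>r\<in>{0..1}. (\<lambda>N. real (M N) / real N) \<longlonglongrightarrow> r \<longrightarrow>
          (r < r_star p0 p1 \<longrightarrow>
            (\<lambda>N. speed x0 N (M N) p0 p1) \<longlonglongrightarrow> 2 * p1 - 1) \<and>
          (r_star p0 p1 < r \<longrightarrow>
            (\<lambda>N. speed x0 N (M N) p0 p1) \<longlonglongrightarrow> 2 * p0 - 1)) \<and>
        (\<forall>\<alpha> :: ennreal.
          (\<lambda>N. real (M N) / real N) \<longlonglongrightarrow> r_star p0 p1 \<and>
          (\<lambda>N. ennreal ((p0 * (1 - p1) / (p1 * (1 - p0)))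
                   powr (real (M N) - real N * r_star p0 p1))) \<longlonglongrightarrow> \<alpha> \<longrightarrow>
          (\<lambda>N. speed x0 N (M N) p0 p1) \<longlonglongrightarrow>
            (if \<alpha> = \<infinity> then 2 * p1 - 1
             else ((2 * p0 - 1) * (1 - p1) + (2 * p1 - 1) * (1 - p0) * enn2real \<alpha>) /
                  (1 - p1 + (1 - p0) * enn2real \<alpha>))))"
proof (intro conjI allI ballI impI)
  fix p1 :: real assume "p1 \<in> {0<..<1}"
  then show "strict_mono_on {0<..<p1} (\<lambda>p0. r_star p0 p1)"
    by (auto intro!: strict_mono_onI r_star_mono_left)
next
  fix p0 :: real assume "p0 \<in> {0<..<1}"
  then show "strict_mono_on {p0<..<1} (\<lambda>p1. r_star p0 p1)"
    by (auto intro!: strict_mono_onI r_star_mono_right)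
next
  fix p0 p1 :: real assume "0 < p0 \<and> p0 < p1 \<and> p1 < 1"
  then show "p0 < r_star p0 p1" "r_star p0 p1 < p1" by (auto intro: r_star_bounds)
next
  fix p0 p1 :: real and x0 :: int and M :: "nat \<Rightarrow> nat"
  assume *: "0 < p0 \<and> p0 < p1 \<and> p1 < 1 \<and> (\<forall>N\<ge>1. 1 \<le> M N \<and> M N \<le> N)"
  then have p: "0 < p0" "p0 < p1" "p1 < 1" and M: "\<forall>N\<ge>1. M N \<le> N" by auto
  have speed: "(\<lambda>N. speed x0 N (M N) p0 p1) \<longlonglongrightarrow> 2 * s - 1"
    if "(\<lambda>N. right_density N (M N) p0 p1) \<longlonglongrightarrow> s" for s
  proof -
    have "(\<lambda>N. 2 * right_density N (M N) p0 p1 - 1) \<longlonglongrightarrow> 2 * s - 1"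
      by (intro tendsto_intros that)
    \<comment> \<open>The bounds on \<open>M N\<close> are given from \<open>N = 1\<close> on, hence
      an eventual equality.\<close>
    moreover have "\<forall>\<^sub>F N in sequentially. 2 * right_density N (M N) p0 p1 - 1 = speed x0 N (M N) p0 p1"
      using eventually_ge_at_top[of 1]
      by eventually_elim (use p M in \<open>simp add: speed_eq\<close>)
    ultimately show ?thesis by (simp add: tendsto_cong)
  qed
  note lim = right_density_limits[OF p M]
  {
    fix r assume r: "(\<lambda>N. real (M N) / real N) \<longlonglongrightarrow> r"
    show "(\<lambda>N. speed x0 N (M N) p0 p1) \<longlonglongrightarrow> 2 * p1 - 1" if "r < r_star p0 p1"
      using lim(1)[OF r that] by (rule speed)
    show "(\<lambda>N. speed x0 N (M N) p0 p1) \<longlonglongrightarrow> 2 * p0 - 1" if "r_star p0 p1 < r"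
      using lim(2)[OF r that] by (rule speed)
  }
  fix \<alpha> :: ennreal
  define x where "x N = (p0 * (1 - p1) / (p1 * (1 - p0))) powr (real (M N) - real N * r_star p0 p1)" for N
  assume "(\<lambda>N. real (M N) / real N) \<longlonglongrightarrow> r_star p0 p1 \<and>
    (\<lambda>N. ennreal ((p0 * (1 - p1) / (p1 * (1 - p0))) powr (real (M N) - real N * r_star p0 p1))) \<longlonglongrightarrow> \<alpha>"
  then have r: "(\<lambda>N. real (M N) / real N) \<longlonglongrightarrow> r_star p0 p1"
    and \<alpha>: "(\<lambda>N. ennreal (x N)) \<longlonglongrightarrow> \<alpha>" by (simp_all add: x_def)
  show "(\<lambda>N. speed x0 N (M N) p0 p1) \<longlonglongrightarrow>
    (if \<alpha> = \<infinity> then 2 * p1 - 1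
     else ((2 * p0 - 1) * (1 - p1) + (2 * p1 - 1) * (1 - p0) * enn2real \<alpha>) /
          (1 - p1 + (1 - p0) * enn2real \<alpha>))"
  proof (cases "\<alpha> = \<infinity>")
    case True
    then have "filterlim x at_top sequentially"
      using \<alpha> by (simp add: ennreal_tendsto_top_eq_at_top)
    then have "(\<lambda>N. right_density N (M N) p0 p1) \<longlonglongrightarrow> p1"
      unfolding x_def [abs_def] by (rule lim(4)[OF r refl])
    from speed[OF this] show ?thesis using True by simp
  next
    case False
    define l where "l = enn2real \<alpha>"
    have l: "0 \<le> l" by (simp add: l_def)
    have "(\<lambda>N. ennreal (x N)) \<longlonglongrightarrow> ennreal l" using \<alpha> False by (simp add: l_def less_top)
    then have "(\<lambda>N. enn2real (ennreal (x N))) \<longlonglongrightarrow> l" using l by (rule tendsto_enn2real)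
    then have "x \<longlonglongrightarrow> l" by (simp add: x_def [abs_def])
    then have "(\<lambda>N. right_density N (M N) p0 p1) \<longlonglongrightarrow>
        (p0 * (1 - p1) + p1 * (1 - p0) * l) / (1 - p1 + (1 - p0) * l)"
      unfolding x_def [abs_def] by (rule lim(3)[OF r refl])
    from speed[OF this]
    have "(\<lambda>N. speed x0 N (M N) p0 p1) \<longlonglongrightarrow>
        2 * ((p0 * (1 - p1) + p1 * (1 - p0) * l) / (1 - p1 + (1 - p0) * l)) - 1" .
    \<comment> \<open>The affine map from density to speed commutes with the weighted average, whose
      weights are \<open>1 - p1\<close> and \<open>(1 - p0) * l\<close>.\<close>
    moreover have "2 * ((p0 * (1 - p1) + p1 * (1 - p0) * l) / (1 - p1 + (1 - p0) * l)) - 1 =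
        ((2 * p0 - 1) * (1 - p1) + (2 * p1 - 1) * (1 - p0) * l) / (1 - p1 + (1 - p0) * l)"
    proof -
      have "0 < 1 - p1 + (1 - p0) * l" using p l by (intro add_pos_nonneg) auto
      then show ?thesis by (simp add: field_simps)
    qed
    ultimately show ?thesis using False by (simp add: l_def)
  qed
qed

end
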